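(* Let $q$ be a power of a prime $p\ne 7$ and let $a\in\mathbb F_q$ be such that $f=X^7+X^6+a\in\mathbb F_q[X]$ is irreducible. If $\theta_{7,7}(1,0,0,0,0,0,a)\ne 0$ (evaluated in $\mathbb F_q$), then $f$ is normal over $\mathbb F_q$.
   Context: A monic irreducible polynomial of degree $n$ over $\mathbb F_q$ is called normal if its roots are linearly independent over $\mathbb F_q$. Let $\epsilon_7=e^{2\pi\sqrt{-1}/7}$ and $\Psi_7(X_0,\dots,X_6)=\prod_{i\in(\mathbb Z/7\mathbb Z)^\times}\bigl(\sum_{j\in\mathbb Z/7\mathbb Z}\epsilon_7^{ij}X_j\bigr)\in\mathbb Z[X_0,\dots,X_6]$. Let the symmetric group $S_7$ act on $\mathbb Z[X_0,\dots,X_6]$ by permuting the indeterminates, and define $\Theta_{7,7}=\prod_\phi\phi(\Psi_7)$, where $\phi$ runs over a left transversal of the stabilizer of $\Psi_7$ in $S_7$; this is a symmetric polynomial in $\mathbb Z[X_0,\dots,X_6]$. Let $\theta_{7,7}\in\mathbb Z[s_1,\dots,s_7]$ be its symmetric reduction, i.e. the unique polynomial with $\Theta_{7,7}(X_0,\dots,X_6)=\theta_{7,7}(s_1,\dots,s_7)$, where $s_i$ is the $i$-th elementary symmetric polynomial in $X_0,\dots,X_6$. Evaluation of $\theta_{7,7}$ at elements of $\mathbb F_q$ is done after reducing its integer coefficients modulo $p$. *)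

theory Defs
  imports Complex_Main "HOL-Library.Poly_Mapping" "HOL-Combinatorics.Permutations"
    "HOL-Computational_Algebra.Polynomial" "HOL-Computational_Algebra.Primes"
begin

text \<open>A polynomial in the indeterminates X_0, X_1, ... is a finitely supported map from
  monomials (exponent vectors nat =>0 nat) to coefficients; poly_mapping gives the
  ring structure (convolution product).\<close>

type_synonym 'a mpoly = "(nat \<Rightarrow>\<^sub>0 nat) \<Rightarrow>\<^sub>0 'a"

definition mvar :: "nat \<Rightarrow> 'a::comm_semiring_1 mpoly" where
  "mvar i = Poly_Mapping.single (Poly_Mapping.single i 1) 1"

definition mconst :: "'a::comm_semiring_1 \<Rightarrow> 'a mpoly" where
  "mconst c = Poly_Mapping.single 0 c"

definition minsert :: "('a::zero \<Rightarrow> 'b::comm_semiring_1) \<Rightarrow> (nat \<Rightarrow> 'b) \<Rightarrow> 'a mpoly \<Rightarrow> 'b" where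
  "minsert h x P = (\<Sum>m\<in>Poly_Mapping.keys P.
       h (Poly_Mapping.lookup P m) * (\<Prod>i\<in>Poly_Mapping.keys m. x i ^ Poly_Mapping.lookup m i))"

definition mperm :: "(nat \<Rightarrow> nat) \<Rightarrow> 'a::comm_semiring_1 mpoly \<Rightarrow> 'a mpoly" where
  "mperm \<sigma> P = minsert mconst (\<lambda>j. mvar (\<sigma> j)) P"

definition eps7 :: complex where
  "eps7 = cis (2 * pi / 7)"

definition Psi7 :: "complex mpoly" where
  "Psi7 = (\<Prod>i\<in>{1..6::nat}. \<Sum>j<7::nat. mconst (eps7 ^ (i * j)) * mvar j)"

text \<open>The product of phi(Psi_7) over a left transversal of the stabilizer of Psi_7 in S_7
  is the product of the distinct elements of the S_7-orbit of Psi_7 (the map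
  phi Stab -> phi(Psi_7) being a bijection between left cosets and the orbit).\<close>
definition Theta77 :: "complex mpoly" where
  "Theta77 = \<Prod> {mperm \<sigma> Psi7 | \<sigma>. \<sigma> permutes {0..<7}}"

definition esym7 :: "nat \<Rightarrow> 'a::comm_semiring_1 mpoly" where
  "esym7 k = (\<Sum>S\<in>{S. S \<subseteq> {0..<7} \<and> card S = k}. \<Prod>i\<in>S. mvar i)"

text \<open>theta_{7,7} in Z[s_1,...,s_7]: s_k is represented by the indeterminate with index k;
  it is the unique integer polynomial in these indeterminates with
  Theta_{7,7}(X_0..X_6) = theta_{7,7}(s_1,...,s_7).\<close>
definition theta77 :: "int mpoly" where
  "theta77 = (THE t. (\<forall>m\<in>Poly_Mapping.keys t. Poly_Mapping.keys m \<subseteq> {1..7})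
                  \<and> minsert of_int esym7 t = Theta77)"

definition eval_theta77 :: "(nat \<Rightarrow> 'a::comm_ring_1) \<Rightarrow> 'a" where
  "eval_theta77 c = minsert of_int c theta77"

text \<open>Given a field embedding h : F_q -> K such that f splits over K, f is normal if it
  is monic irreducible and its roots in K (listed with multiplicity) are linearly independent
  over the subfield h(F_q).\<close>
definition roots_lin_indep_over :: "('a::field \<Rightarrow> 'b::field) \<Rightarrow> 'a poly \<Rightarrow> bool" where
  "roots_lin_indep_over h f \<longleftrightarrow>
     (let R = proots (map_poly h f) in
       (\<forall>x. count R x \<le> 1) \<and>
       (\<forall>c :: 'b \<Rightarrow> 'a. (\<Sum>x\<in>set_mset R. h (c x) * x) = 0 \<longrightarrow> (\<forall>x\<in>set_mset R. c x = 0)))"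

definition normal_poly_over :: "('a::field \<Rightarrow> 'b::field) \<Rightarrow> 'a poly \<Rightarrow> bool" where
  "normal_poly_over h f \<longleftrightarrow> lead_coeff f = 1 \<and> irreducible f \<and> roots_lin_indep_over h f"

end

theory Submission
  imports "HOL-Number_Theory.Residues" "HOL-Algebra.Algebraic_Closure_Type" Defs
begin

text \<open>
  Write the roots of \<open>f\<close> as a Frobenius orbit \<open>r, r\<^sup>q, r\<^bsup>q^2\<^esup>, \<dots>\<close> and put \<open>x\<^sub>j = - r\<^bsup>q^j\<^esup>\<close>; then
  the elementary symmetric functions of the \<open>x\<^sub>j\<close> are \<open>1, 0, 0, 0, 0, 0, a\<close>. The polynomial \<open>\<Psi>\<^sub>7\<close> has
  integer coefficients and is given by a formula valid in every commutative ring, so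
  \<open>\<theta>\<^sub>7\<^sub>,\<^sub>7(1, 0, \<dots>, 0, a)\<close> is a product of specialisations of \<open>\<Psi>\<^sub>7\<close>, one of them \<open>\<Psi>\<^sub>7(x\<^sub>0, \<dots>, x\<^sub>6)\<close>.
  If it is nonzero then, over a field with a primitive seventh root of unity, all
  \<open>\<Sum>\<^sub>j \<epsilon>\<^sup>i\<^sup>j x\<^sub>j\<close> are nonzero: for \<open>i \<noteq> 0\<close> they divide \<open>\<Psi>\<^sub>7(x)\<close>, and for \<open>i = 0\<close> the sum is \<open>1\<close>.
  They are the eigenvalues of the circulant matrix of the \<open>x\<^sub>j\<close>, whose kernel contains every
  linear relation between the roots with coefficients in \<open>GF(q)\<close>, as one sees by applying Frobenius.

  Since \<open>theta77\<close> is a definite description, both the existence and the uniqueness part of the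
  fundamental theorem of symmetric polynomials are needed; both follow from the
  lexicographically leading monomials of products of elementary symmetric polynomials.
\<close>

hide_const (open) Divisibility.irreducible Divisibility.prime

section \<open>Evaluation of polynomials\<close>

text \<open>One interface for coefficient maps, evaluations, permutations of variables,
  \<open>h\<close>, Frobenius and the map into the algebraic closure, so that each transfer rule is
  proved once.\<close>

locale unital_hom =
  fixes \<phi> :: "'a::comm_ring_1 \<Rightarrow> 'b::comm_ring_1"
  assumes hom_one [simp]: "\<phi> 1 = 1"
    and hom_add [simp]: "\<phi> (x + y) = \<phi> x + \<phi> y"
    and hom_mult [simp]: "\<phi> (x * y) = \<phi> x * \<phi> y"
begin

lemma hom_zero [simp]: "\<phi> 0 = 0"
  using hom_add[of 0 0] by simp

lemma hom_uminus [simp]: "\<phi> (- x) = - \<phi> x"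
  using hom_add[of x "- x"] by (simp add: eq_neg_iff_add_eq_0 add.commute)

lemma hom_diff [simp]: "\<phi> (x - y) = \<phi> x - \<phi> y"
  using hom_add[of x "- y"] by simp

lemma hom_sum: "\<phi> (sum f A) = (\<Sum>i\<in>A. \<phi> (f i))"
  by (induction A rule: infinite_finite_induct) auto

lemma hom_prod: "\<phi> (prod f A) = (\<Prod>i\<in>A. \<phi> (f i))"
  by (induction A rule: infinite_finite_induct) auto

lemma hom_power: "\<phi> (x ^ n) = \<phi> x ^ n"
  by (induction n) auto

lemma hom_of_int: "\<phi> (of_int n) = of_int n"
proof -
  have "\<phi> (of_nat k) = of_nat k" for k
    by (induction k) auto
  then show ?thesis
    by (cases n) (simp_all del: of_nat_Suc)
qed

end

lemma unital_hom_of_int: "unital_hom (of_int :: int \<Rightarrow> 'a::comm_ring_1)"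
  by unfold_locales auto

lemma unital_hom_mconst: "unital_hom (mconst :: 'a::comm_ring_1 \<Rightarrow> 'a mpoly)"
  by unfold_locales (auto simp: mconst_def single_add mult_single)

definition mmonom :: "(nat \<Rightarrow> 'a::comm_semiring_1) \<Rightarrow> (nat \<Rightarrow>\<^sub>0 nat) \<Rightarrow> 'a" where
  "mmonom x m = (\<Prod>i\<in>Poly_Mapping.keys m. x i ^ Poly_Mapping.lookup m i)"

lemma mmonom_superset:
  assumes "finite A" "Poly_Mapping.keys m \<subseteq> A"
  shows "mmonom x m = (\<Prod>i\<in>A. x i ^ Poly_Mapping.lookup m i)"
  unfolding mmonom_def
  by (rule prod.mono_neutral_left) (use assms in \<open>auto simp: in_keys_iff\<close>)

lemma mmonom_zero [simp]: "mmonom x 0 = 1"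
  by (simp add: mmonom_def)

lemma mmonom_add: "mmonom x (m + n) = mmonom x m * mmonom x n"
proof -
  let ?A = "Poly_Mapping.keys m \<union> Poly_Mapping.keys n"
  have "mmonom x (m + n) = (\<Prod>i\<in>?A. x i ^ Poly_Mapping.lookup (m + n) i)"
    by (rule mmonom_superset) (auto simp: Poly_Mapping.keys_add)
  also have "\<dots> = (\<Prod>i\<in>?A. x i ^ Poly_Mapping.lookup m i) * (\<Prod>i\<in>?A. x i ^ Poly_Mapping.lookup n i)"
    by (simp add: lookup_add power_add prod.distrib)
  also have "\<dots> = mmonom x m * mmonom x n"
    by (simp add: mmonom_superset[of ?A])
  finally show ?thesis .
qed

lemma mmonom_single [simp]: "mmonom x (Poly_Mapping.single i n) = x i ^ n"
  by (cases "n = 0") (auto simp: mmonom_def)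

lemma mmonom_mvar: "mmonom mvar m = Poly_Mapping.single m 1"
proof -
  have pow: "(mvar i :: 'a mpoly) ^ n = Poly_Mapping.single (Poly_Mapping.single i n) 1" for i n
    by (induction n) (auto simp: mvar_def mult_single simp flip: single_add)
  have pr: "(\<Prod>i\<in>A. Poly_Mapping.single (f i) 1 :: 'a mpoly) = Poly_Mapping.single (sum f A) 1"
    if "finite A" for A :: "nat set" and f
    using that by (induction A) (auto simp: mult_single)
  have "(\<Sum>i\<in>Poly_Mapping.keys m. Poly_Mapping.single i (Poly_Mapping.lookup m i)) = m"
    by (rule poly_mapping_eqI) (auto simp: lookup_sum lookup_single when_def in_keys_iff sum.delta)
  then show ?thesis
    by (simp add: mmonom_def pow pr)
qed

lemma (in unital_hom) hom_mmonom: "\<phi> (mmonom x m) = mmonom (\<lambda>i. \<phi> (x i)) m"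
  by (simp add: mmonom_def hom_prod hom_power)

lemma minsert_mmonom:
  "minsert h x P = (\<Sum>m\<in>Poly_Mapping.keys P. h (Poly_Mapping.lookup P m) * mmonom x m)"
  by (simp add: minsert_def mmonom_def)

lemma sum_single_keys:
  "(\<Sum>m\<in>Poly_Mapping.keys P. Poly_Mapping.single m (Poly_Mapping.lookup P m)) = P"
  by (rule poly_mapping_eqI) (auto simp: lookup_sum lookup_single when_def in_keys_iff sum.delta)

lemma minsert_mconst_mvar: "minsert mconst mvar P = P"
  by (simp add: minsert_mmonom mmonom_mvar mconst_def mult_single sum_single_keys)

context unital_hom
begin

lemma minsert_superset:
  assumes "finite A" "Poly_Mapping.keys P \<subseteq> A"
  shows "minsert \<phi> x P = (\<Sum>m\<in>A. \<phi> (Poly_Mapping.lookup P m) * mmonom x m)"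
  unfolding minsert_mmonom
  by (rule sum.mono_neutral_left) (use assms in \<open>auto simp: in_keys_iff\<close>)

lemma minsert_single [simp]: "minsert \<phi> x (Poly_Mapping.single m c) = \<phi> c * mmonom x m"
  by (cases "c = 0") (auto simp: minsert_mmonom)

lemma minsert_add: "minsert \<phi> x (P + Q) = minsert \<phi> x P + minsert \<phi> x Q"
proof -
  let ?A = "Poly_Mapping.keys P \<union> Poly_Mapping.keys Q"
  have "minsert \<phi> x (P + Q) = (\<Sum>m\<in>?A. \<phi> (Poly_Mapping.lookup (P + Q) m) * mmonom x m)"
    by (rule minsert_superset) (auto simp: Poly_Mapping.keys_add)
  also have "\<dots> = minsert \<phi> x P + minsert \<phi> x Q"
    by (simp add: minsert_superset[of ?A] lookup_add sum.distrib algebra_simps)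
  finally show ?thesis .
qed

lemma minsert_zero [simp]: "minsert \<phi> x 0 = 0"
  by (simp add: minsert_mmonom)

lemma minsert_sum: "minsert \<phi> x (sum f A) = (\<Sum>i\<in>A. minsert \<phi> x (f i))"
  by (induction A rule: infinite_finite_induct) (auto simp: minsert_add)

lemma minsert_mult: "minsert \<phi> x (P * Q) = minsert \<phi> x P * minsert \<phi> x Q"
proof -
  let ?s = "\<lambda>P m. Poly_Mapping.single m (Poly_Mapping.lookup P m)"
  have "minsert \<phi> x (P * Q)
      = minsert \<phi> x ((\<Sum>m\<in>Poly_Mapping.keys P. ?s P m) * (\<Sum>n\<in>Poly_Mapping.keys Q. ?s Q n))"
    by (simp only: sum_single_keys)
  also have "\<dots> = (\<Sum>m\<in>Poly_Mapping.keys P. \<Sum>n\<in>Poly_Mapping.keys Q.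
      \<phi> (Poly_Mapping.lookup P m) * mmonom x m * (\<phi> (Poly_Mapping.lookup Q n) * mmonom x n))"
    by (simp add: sum_product mult_single minsert_sum mmonom_add mult_ac)
  also have "\<dots> = minsert \<phi> x P * minsert \<phi> x Q"
    by (simp add: minsert_mmonom sum_product)
  finally show ?thesis .
qed

lemma unital_hom_minsert: "unital_hom (minsert \<phi> x)"
proof
  show "minsert \<phi> x 1 = 1"
    by (simp add: minsert_mmonom lookup_one)
qed (simp_all add: minsert_add minsert_mult)

lemma minsert_mvar [simp]: "minsert \<phi> x (mvar i) = x i"
  by (simp add: mvar_def)

lemma minsert_mconst [simp]: "minsert \<phi> x (mconst c) = \<phi> c"
  by (simp add: mconst_def)

lemma hom_minsert: "\<phi> (minsert h x P) = minsert (\<lambda>c. \<phi> (h c)) (\<lambda>i. \<phi> (x i)) P"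
  by (simp add: minsert_mmonom hom_sum hom_mmonom)

lemma hom_minsert_of_int: "\<phi> (minsert of_int x P) = minsert of_int (\<lambda>i. \<phi> (x i)) P"
  by (simp add: hom_minsert hom_of_int)

end

section \<open>Integer polynomials, permutation of variables and extension of coefficients\<close>

lemma unital_hom_minsert_of_int:
  "unital_hom (minsert of_int x :: int mpoly \<Rightarrow> 'a::comm_ring_1)"
  by (rule unital_hom.unital_hom_minsert[OF unital_hom_of_int])

lemma of_int_eq_mconst: "(of_int :: int \<Rightarrow> int mpoly) = mconst"
  by (rule ext) (metis mconst_def of_int_eq_id id_apply single_of_int)

lemma mperm_eq_minsert_of_int: "mperm \<sigma> P = minsert of_int (\<lambda>j. mvar (\<sigma> j)) P" for P :: "int mpoly"
  by (simp add: of_int_eq_mconst mperm_def)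

lemma unital_hom_mperm: "unital_hom (mperm \<sigma> :: 'a::comm_ring_1 mpoly \<Rightarrow> 'a mpoly)"
  unfolding mperm_def by (rule unital_hom.unital_hom_minsert[OF unital_hom_mconst])

lemma mperm_mvar [simp]: "mperm \<sigma> (mvar i :: 'a::comm_ring_1 mpoly) = mvar (\<sigma> i)"
  unfolding mperm_def by (simp add: unital_hom.minsert_mvar[OF unital_hom_mconst])

lemma mperm_mperm: "mperm \<sigma> (mperm \<tau> P) = mperm (\<sigma> \<circ> \<tau>) P" for P :: "'a::comm_ring_1 mpoly"
proof -
  have "mperm \<sigma> (mperm \<tau> P) = minsert (\<lambda>c. mperm \<sigma> (mconst c)) (\<lambda>j. mperm \<sigma> (mvar (\<tau> j))) P"
    unfolding mperm_def[of \<tau>] by (rule unital_hom.hom_minsert[OF unital_hom_mperm])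
  then show ?thesis
    by (simp add: mperm_def o_def unital_hom.minsert_mvar[OF unital_hom_mconst] unital_hom.minsert_mconst[OF unital_hom_mconst])
qed

lemma mperm_id: "mperm id P = P"
  by (simp add: mperm_def minsert_mconst_mvar)

text \<open>The coefficientwise embedding of Z[X] into C[X], encoded as an evaluation so that the
  rules for \<open>minsert\<close> apply to it.\<close>

definition mcomplex :: "int mpoly \<Rightarrow> complex mpoly" where
  "mcomplex P = minsert of_int mvar P"

lemma lookup_mcomplex: "Poly_Mapping.lookup (mcomplex P) m = of_int (Poly_Mapping.lookup P m)"
proof -
  have 1: "of_int c * Poly_Mapping.single n (1::complex) = Poly_Mapping.single n (of_int c)" 
    for c and n :: "nat \<Rightarrow>\<^sub>0 nat"
    by (simp add: mult_single flip: single_of_int)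
  show ?thesis
    by (auto simp: mcomplex_def minsert_mmonom mmonom_mvar 1 lookup_sum
        lookup_single when_def in_keys_iff sum.delta)
qed

lemma inj_mcomplex: "inj mcomplex"
  by (rule injI) (metis lookup_mcomplex of_int_eq_iff poly_mapping_eqI)

lemma unital_hom_mcomplex: "unital_hom mcomplex"
  unfolding mcomplex_def[abs_def] by (rule unital_hom_minsert_of_int)

lemma mcomplex_mvar [simp]: "mcomplex (mvar i) = mvar i"
  by (simp add: mcomplex_def unital_hom.minsert_mvar[OF unital_hom_of_int])

lemma mperm_mcomplex: "mperm \<sigma> (mcomplex P) = mcomplex (mperm \<sigma> P)"
  by (simp add: mcomplex_def unital_hom.hom_minsert_of_int[OF unital_hom_mperm]
      mperm_eq_minsert_of_int unital_hom.hom_minsert_of_int[OF unital_hom_minsert_of_int]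
      unital_hom.minsert_mvar[OF unital_hom_of_int])

section \<open>Leading monomials and algebraic independence\<close>

lemma poly_mapping_less_iff:
  fixes m n :: "'a::linorder \<Rightarrow>\<^sub>0 'b::{zero,linorder}"
  shows "m < n \<longleftrightarrow> (\<exists>k. Poly_Mapping.lookup m k < Poly_Mapping.lookup n k
      \<and> (\<forall>k'<k. Poly_Mapping.lookup m k' = Poly_Mapping.lookup n k'))"
  by (simp add: less_poly_mapping.rep_eq less_fun_def)

text \<open>Monomials are compared by the order that the library puts on \<open>poly_mapping\<close>: it is
  lexicographic with index \<open>0\<close> most significant, so \<open>X\<^sub>0 > X\<^sub>1 > \<dots> > X\<^sub>6\<close>.\<close>

definition monic_lead :: "'a::comm_ring_1 mpoly \<Rightarrow> (nat \<Rightarrow>\<^sub>0 nat) \<Rightarrow> bool" where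
  "monic_lead P m \<longleftrightarrow> (\<forall>k\<in>Poly_Mapping.keys (P - Poly_Mapping.single m 1). k < m)"

lemma monic_lead_one: "monic_lead 1 0"
  by (simp add: monic_lead_def)

text \<open>The monomial order is compatible with addition of exponents, so every other term of the
  product is smaller; the leading term has coefficient 1 and survives over any commutative
  ring.\<close>

lemma monic_lead_mult:
  assumes "monic_lead P m" "monic_lead Q n"
  shows "monic_lead (P * Q) (m + n)"
proof -
  let ?s = "\<lambda>m. Poly_Mapping.single m (1::'a)"
  define P' where "P' = P - ?s m"
  define Q' where "Q' = Q - ?s n"
  have P: "P = ?s m + P'" "\<And>k. k \<in> Poly_Mapping.keys P' \<Longrightarrow> k < m"
    and Q: "Q = ?s n + Q'" "\<And>k. k \<in> Poly_Mapping.keys Q' \<Longrightarrow> k < n"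
    using assms by (auto simp: P'_def Q'_def monic_lead_def)
  have "P * Q - ?s (m + n) = ?s m * Q' + P' * ?s n + P' * Q'"
    by (simp add: P(1) Q(1) algebra_simps mult_single)
  moreover have "k < m + n" if "k \<in> Poly_Mapping.keys (?s m * Q')" for k
    using that subsetD[OF keys_mult that] by (auto split: if_splits dest: Q(2))
  moreover have "k < m + n" if "k \<in> Poly_Mapping.keys (P' * ?s n)" for k
    using that subsetD[OF keys_mult that] by (auto split: if_splits dest: P(2))
  moreover have "k < m + n" if "k \<in> Poly_Mapping.keys (P' * Q')" for k
    using subsetD[OF keys_mult that] by (auto intro!: add_strict_mono dest: P(2) Q(2))
  ultimately show ?thesis
    unfolding monic_lead_def by (auto dest!: subsetD[OF Poly_Mapping.keys_add])
qed

lemma monic_lead_prod: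
  assumes "finite A" "\<And>i. i \<in> A \<Longrightarrow> monic_lead (f i) (g i)"
  shows "monic_lead (\<Prod>i\<in>A. f i) (\<Sum>i\<in>A. g i)"
  using assms by (induction A) (auto intro: monic_lead_one monic_lead_mult)

lemma monic_lead_power: "monic_lead P m \<Longrightarrow> monic_lead (P ^ n) (\<Sum>_<n. m)"
  using monic_lead_prod[of "{..<n}" "\<lambda>_. P" "\<lambda>_. m"] by simp

lemma lookup_monic_lead:
  assumes "monic_lead P m"
  shows "Poly_Mapping.lookup P m = 1" "Poly_Mapping.lookup P k \<noteq> 0 \<Longrightarrow> k \<le> m"
proof -
  have "m \<notin> Poly_Mapping.keys (P - Poly_Mapping.single m 1)"
    using assms by (auto simp: monic_lead_def)
  then show "Poly_Mapping.lookup P m = 1"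
    by (simp add: in_keys_iff lookup_minus)
  assume "Poly_Mapping.lookup P k \<noteq> 0"
  then show "k \<le> m"
    using assms unfolding monic_lead_def
    by (cases "k = m") (auto simp: in_keys_iff lookup_minus lookup_single dest!: bspec[of _ _ k])
qed

section \<open>Leading monomials of elementary symmetric polynomials and of their products\<close>

definition prefix_monom :: "nat \<Rightarrow> nat \<Rightarrow>\<^sub>0 nat" where
  "prefix_monom k = (\<Sum>i<k. Poly_Mapping.single i 1)"

lemma lookup_sum_single:
  "finite S \<Longrightarrow> Poly_Mapping.lookup (\<Sum>i\<in>S. Poly_Mapping.single i (1::nat)) j = (if j \<in> S then 1 else 0)"
  by (simp add: lookup_sum lookup_single when_def)

lemma prod_mvar:
  "finite S \<Longrightarrow> (\<Prod>i\<in>S. mvar i :: 'a::comm_ring_1 mpoly)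
     = Poly_Mapping.single (\<Sum>i\<in>S. Poly_Mapping.single i 1) 1"
  by (induction S rule: finite_induct) (auto simp: mvar_def mult_single)

text \<open>Any other \<open>k\<close>-subset \<open>S\<close> misses an index below
  \<open>k\<close>. At the least missing index \<open>j\<close> the exponent vectors first differ,
  and there \<open>prefix_monom k\<close> has 1 while \<open>S\<close> has 0.\<close>

lemma monic_lead_esym7:
  assumes "k \<le> 7"
  shows "monic_lead (esym7 k :: 'a::comm_ring_1 mpoly) (prefix_monom k)"
proof -
  let ?A = "{S. S \<subseteq> {0..<7::nat} \<and> card S = k}"
  let ?e = "\<lambda>S. \<Sum>i\<in>S. Poly_Mapping.single i (1::nat)"
  have fin: "finite ?A"
    by (rule finite_subset[of _ "Pow {0..<7}"]) auto
  have mem: "{..<k} \<in> ?A"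
    using assms by auto
  have fS: "finite S" if "S \<in> ?A" for S
    using that finite_subset by auto
  have "esym7 k = (\<Sum>S\<in>?A. Poly_Mapping.single (?e S) (1::'a))"
    unfolding esym7_def using fS by (intro sum.cong refl prod_mvar) auto
  also have "\<dots> = Poly_Mapping.single (prefix_monom k) 1 + (\<Sum>S\<in>?A - {{..<k}}. Poly_Mapping.single (?e S) 1)"
    unfolding prefix_monom_def by (rule sum.remove[OF fin mem])
  finally have eq: "esym7 k - Poly_Mapping.single (prefix_monom k) (1::'a)
      = (\<Sum>S\<in>?A - {{..<k}}. Poly_Mapping.single (?e S) 1)"
    by (simp only: add_diff_cancel_left')
  have less: "?e S < prefix_monom k" if S: "S \<in> ?A" "S \<noteq> {..<k}" for S
  proof -
    have "card S = card {..<k}" using S by simp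
    then have "\<not> {..<k} \<subseteq> S"
      using card_subset_eq[OF fS[OF S(1)]] S(2) by metis
    then obtain i0 where i0: "i0 \<notin> S" "i0 < k" by auto
    define j where "j = (LEAST i. i \<notin> S)"
    have j: "j \<notin> S" "j < k"
      using LeastI[of "\<lambda>i. i \<notin> S" i0] Least_le[of "\<lambda>i. i \<notin> S" i0] i0 by (auto simp: j_def)
    have below: "\<forall>i<j. i \<in> S"
      using not_less_Least by (auto simp: j_def)
    show ?thesis
      unfolding poly_mapping_less_iff prefix_monom_def lookup_sum_single[OF fS[OF S(1)]]
        lookup_sum_single[OF finite_lessThan]
      using j below by (intro exI[of _ j]) auto
  qed
  have "m < prefix_monom k"
    if "m \<in> Poly_Mapping.keys (\<Sum>S\<in>?A - {{..<k}}. Poly_Mapping.single (?e S) (1::'a))" for m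
  proof -
    have "Poly_Mapping.lookup (\<Sum>S\<in>?A - {{..<k}}. Poly_Mapping.single (?e S) (1::'a)) m \<noteq> 0"
      using that unfolding in_keys_iff .
    then obtain S where "S \<in> ?A - {{..<k}}" "Poly_Mapping.lookup (Poly_Mapping.single (?e S) (1::'a)) m \<noteq> 0"
      unfolding lookup_sum by (meson sum.neutral)
    then show ?thesis
      using less[of S] by (simp add: lookup_single when_def del: One_nat_def split: if_splits)
  qed
  then show ?thesis
    unfolding monic_lead_def eq by blast
qed

text \<open>The leading exponent of the product of the powers \<open>esym7 k ^ a_k\<close>; the
  inner sum is the \<open>a_k\<close>-fold multiple of \<open>prefix_monom k\<close>, in the shape
  delivered by \<open>monic_lead_power\<close>.\<close>

definition lead_exp :: "(nat \<Rightarrow>\<^sub>0 nat) \<Rightarrow> nat \<Rightarrow>\<^sub>0 nat" where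
  "lead_exp a = (\<Sum>k\<in>Poly_Mapping.keys a. \<Sum>_<Poly_Mapping.lookup a k. prefix_monom k)"

lemma monic_lead_mmonom_esym7:
  assumes "Poly_Mapping.keys a \<subseteq> {1..7}"
  shows "monic_lead (mmonom esym7 a :: 'a::comm_ring_1 mpoly) (lead_exp a)"
  unfolding mmonom_def lead_exp_def
  by (intro monic_lead_prod monic_lead_power monic_lead_esym7) (use assms in auto)

text \<open>\<open>X_i\<close> occurs in \<open>prefix_monom k\<close> exactly when
  \<open>i < k\<close>, and then once, so only the entries of \<open>a\<close> beyond
  \<open>i\<close> contribute.\<close>

lemma lookup_lead_exp:
  assumes "Poly_Mapping.keys a \<subseteq> {1..7}"
  shows "Poly_Mapping.lookup (lead_exp a) i = (\<Sum>k\<in>{Suc i..7}. Poly_Mapping.lookup a k)"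
proof -
  have "Poly_Mapping.lookup (lead_exp a) i
      = (\<Sum>k\<in>Poly_Mapping.keys a. if i < k then Poly_Mapping.lookup a k else 0)"
    by (auto simp del: sum_constant simp: lead_exp_def lookup_sum prefix_monom_def lookup_single
        when_def sum_constant[where 'a = nat] intro!: sum.cong)
  also have "\<dots> = (\<Sum>k\<in>{1..7}. if i < k then Poly_Mapping.lookup a k else 0)"
    by (rule sum.mono_neutral_left) (use assms in \<open>auto simp: in_keys_iff\<close>)
  also have "\<dots> = (\<Sum>k\<in>{Suc i..7}. Poly_Mapping.lookup a k)"
    by (rule sum.mono_neutral_cong_right) auto
  finally show ?thesis .
qed

text \<open>Exponents of \<open>lead_exp a\<close> are tail sums, so \<open>a_k\<close> is recovered
  as the difference of the entries at \<open>k - 1\<close> and \<open>k\<close>.\<close>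

lemma lead_exp_inject:
  assumes "Poly_Mapping.keys a \<subseteq> {1..7}" "Poly_Mapping.keys b \<subseteq> {1..7}" "lead_exp a = lead_exp b"
  shows "a = b"
proof (rule poly_mapping_eqI)
  fix k
  have step: "Poly_Mapping.lookup c k + Poly_Mapping.lookup (lead_exp c) k = Poly_Mapping.lookup (lead_exp c) (k - 1)"
    if "Poly_Mapping.keys c \<subseteq> {1..7}" "k \<in> {1..7}" for c
    using that by (simp add: lookup_lead_exp sum.atLeast_Suc_atMost)
  show "Poly_Mapping.lookup a k = Poly_Mapping.lookup b k"
  proof (cases "k \<in> {1..7}")
    case True
    show ?thesis
      using step[OF assms(1) True] step[OF assms(2) True] assms(3) by simp
  next
    case False
    then have "k \<notin> Poly_Mapping.keys a" "k \<notin> Poly_Mapping.keys b" using assms by auto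
    then show ?thesis by (simp add: in_keys_iff)
  qed
qed

lemma lookup_of_int_mult:
  "Poly_Mapping.lookup (of_int c * P :: int mpoly) k = c * Poly_Mapping.lookup P k"
  by (simp add: of_int_eq_mconst mconst_def map.rep_eq when_def flip: mult_map_scale_conv_mult)

text \<open>By \<open>lead_exp_inject\<close> distinct terms of \<open>t\<close> yield distinct
  leading monomials. The largest of them occurs in no other summand, so its coefficient cannot
  cancel.\<close>

lemma esym7_algebraically_independent:
  fixes t :: "int mpoly"
  assumes "\<forall>m\<in>Poly_Mapping.keys t. Poly_Mapping.keys m \<subseteq> {1..7}"
    and "minsert of_int esym7 t = (0 :: int mpoly)"
  shows "t = 0"
proof (rule ccontr)
  assume "t \<noteq> 0"
  then have ne: "Poly_Mapping.keys t \<noteq> {}" by simp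
  obtain a where a: "a \<in> Poly_Mapping.keys t" "\<And>b. b \<in> Poly_Mapping.keys t \<Longrightarrow> lead_exp b \<le> lead_exp a"
  proof -
    have "Max (lead_exp ` Poly_Mapping.keys t) \<in> lead_exp ` Poly_Mapping.keys t"
      using ne by (intro Max_in) auto
    then obtain a where "a \<in> Poly_Mapping.keys t" "lead_exp a = Max (lead_exp ` Poly_Mapping.keys t)"
      by auto
    then show ?thesis using that by auto
  qed
  have "Poly_Mapping.lookup (of_int (Poly_Mapping.lookup t b) * mmonom esym7 b :: int mpoly) (lead_exp a)
      = (if b = a then Poly_Mapping.lookup t a else 0)" if b: "b \<in> Poly_Mapping.keys t" for b
  proof -
    have L: "monic_lead (mmonom esym7 b :: int mpoly) (lead_exp b)"
      using assms(1) b by (intro monic_lead_mmonom_esym7) auto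
    show ?thesis
    proof (cases "b = a")
      case True
      with L show ?thesis by (simp add: lookup_of_int_mult lookup_monic_lead(1))
    next
      case False
      then have "lead_exp b \<noteq> lead_exp a"
        using lead_exp_inject assms(1) a(1) b by blast
      then have "lead_exp b < lead_exp a" using a(2)[OF b] by simp
      then have "Poly_Mapping.lookup (mmonom esym7 b :: int mpoly) (lead_exp a) = 0"
        using lookup_monic_lead(2)[OF L] by (meson leD)
      with False show ?thesis by (simp add: lookup_of_int_mult)
    qed
  qed
  then have "Poly_Mapping.lookup (minsert of_int esym7 t :: int mpoly) (lead_exp a) = Poly_Mapping.lookup t a"
    using a(1) by (simp add: minsert_mmonom lookup_sum sum.delta)
  then show False
    using assms(2) a(1) by (simp add: in_keys_iff)
qed

section \<open>Reduction of symmetric polynomials\<close>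

text \<open>\<open>map_key \<tau>\<close> precomposes exponents with \<open>\<tau>\<close>, whereas
  renaming variables precomposes them with the inverse; for an involution the two agree. Adjacent
  transpositions are what the leading-term argument uses.\<close>

lemma mmonom_mvar_involution:
  assumes \<tau>: "\<And>i. \<tau> (\<tau> i) = i"
  shows "mmonom (\<lambda>j. mvar (\<tau> j)) m = (Poly_Mapping.single (Poly_Mapping.map_key \<tau> m) 1 :: 'a::comm_ring_1 mpoly)"
proof -
  have inj: "inj \<tau>" by (metis \<tau> injI)
  have keys: "Poly_Mapping.keys (Poly_Mapping.map_key \<tau> m) = \<tau> ` Poly_Mapping.keys m"
  proof -
    have "\<tau> -` A = \<tau> ` A" for A
      using \<tau> by (auto simp: image_iff) metis+
    then show ?thesis by (simp add: keys_map_key[OF inj])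
  qed
  have "mmonom mvar (Poly_Mapping.map_key \<tau> m) = (mmonom (\<lambda>j. mvar (\<tau> j)) m :: 'a mpoly)"
    unfolding mmonom_def keys
    by (subst prod.reindex) (auto intro: inj_on_subset[OF inj] simp: map_key.rep_eq[OF inj] \<tau>)
  then show ?thesis by (simp add: mmonom_mvar)
qed

lemma lookup_mperm_involution:
  assumes \<tau>: "\<And>i. \<tau> (\<tau> i) = i"
  shows "Poly_Mapping.lookup (mperm \<tau> P :: 'a::comm_ring_1 mpoly) m = Poly_Mapping.lookup P (Poly_Mapping.map_key \<tau> m)"
proof -
  have inj: "inj \<tau>" by (metis \<tau> injI)
  have key2: "Poly_Mapping.map_key \<tau> n = m \<longleftrightarrow> n = Poly_Mapping.map_key \<tau> m" for n m :: "nat \<Rightarrow>\<^sub>0 nat"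
    by (auto intro!: poly_mapping_eqI simp: map_key.rep_eq[OF inj] \<tau>)
  show ?thesis
    by (auto simp: mperm_def minsert_mmonom mmonom_mvar_involution[OF \<tau>] mconst_def mult_single
        lookup_sum lookup_single when_def key2 in_keys_iff sum.delta)
qed

section \<open>Polynomials in seven variables and their permutations\<close>

definition mvars7 :: "'a::comm_ring_1 mpoly \<Rightarrow> bool" where
  "mvars7 P \<longleftrightarrow> (\<forall>m\<in>Poly_Mapping.keys P. Poly_Mapping.keys m \<subseteq> {0..<7})"

lemma mvars7_mult: "mvars7 P \<Longrightarrow> mvars7 Q \<Longrightarrow> mvars7 (P * Q)"
  unfolding mvars7_def
  by (auto dest!: subsetD[OF keys_mult] subsetD[OF Poly_Mapping.keys_add])

lemma mvars7_add: "mvars7 P \<Longrightarrow> mvars7 Q \<Longrightarrow> mvars7 (P + Q)"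
  unfolding mvars7_def by (auto dest!: subsetD[OF Poly_Mapping.keys_add])

lemma mvars7_uminus: "mvars7 P \<Longrightarrow> mvars7 (- P)"
  unfolding mvars7_def by (auto simp: in_keys_iff)

lemma mvars7_diff: "mvars7 P \<Longrightarrow> mvars7 Q \<Longrightarrow> mvars7 (P - Q)"
  using mvars7_add[of P "- Q"] by (simp add: mvars7_uminus)

lemma mvars7_mvar: "i < 7 \<Longrightarrow> mvars7 (mvar i)"
  by (auto simp: mvars7_def mvar_def split: if_splits)

lemma mvars7_0: "mvars7 0"
  by (simp add: mvars7_def)

lemma mvars7_1: "mvars7 1"
  by (simp add: mvars7_def)

lemma mvars7_of_int: "mvars7 (of_int c)"
  unfolding mvars7_def by (simp flip: single_of_int)

lemma mvars7_sum: "(\<And>i. i \<in> A \<Longrightarrow> mvars7 (f i)) \<Longrightarrow> mvars7 (sum f A)"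
  by (induction A rule: infinite_finite_induct) (auto intro: mvars7_add mvars7_0)

lemma mvars7_prod: "(\<And>i. i \<in> A \<Longrightarrow> mvars7 (f i)) \<Longrightarrow> mvars7 (prod f A)"
  by (induction A rule: infinite_finite_induct) (auto intro: mvars7_mult mvars7_1)

lemma mvars7_power: "mvars7 P \<Longrightarrow> mvars7 (P ^ n)"
  by (induction n) (auto intro: mvars7_mult mvars7_1)

lemma mvars7_esym7: "mvars7 (esym7 k)"
  unfolding esym7_def by (intro mvars7_sum mvars7_prod mvars7_mvar) auto

lemma mvars7_mmonom_esym7: "mvars7 (mmonom esym7 a)"
  unfolding mmonom_def by (intro mvars7_prod mvars7_power mvars7_esym7)

lemma mvars7_mperm:
  assumes "mvars7 P" "\<And>i. i < 7 \<Longrightarrow> \<sigma> i < 7"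
  shows "mvars7 (mperm \<sigma> P :: int mpoly)"
  unfolding mperm_eq_minsert_of_int minsert_mmonom mmonom_def
  by (intro mvars7_sum mvars7_mult mvars7_of_int mvars7_prod mvars7_power mvars7_mvar)
     (use assms in \<open>force simp: mvars7_def\<close>)

lemma mperm_esym7:
  assumes "\<sigma> permutes {0..<7}"
  shows "mperm \<sigma> (esym7 k :: 'a::comm_ring_1 mpoly) = esym7 k"
proof -
  interpret unital_hom "mperm \<sigma> :: 'a mpoly \<Rightarrow> 'a mpoly" by (rule unital_hom_mperm)
  let ?A = "{S. S \<subseteq> {0..<7::nat} \<and> card S = k}"
  have inj: "inj \<sigma>" using permutes_inj[OF assms] .
  have "mperm \<sigma> (esym7 k :: 'a mpoly) = (\<Sum>S\<in>?A. \<Prod>i\<in>S. mvar (\<sigma> i))"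
    by (simp add: esym7_def hom_sum hom_prod)
  also have "\<dots> = (\<Sum>S\<in>?A. \<Prod>i\<in>\<sigma> ` S. mvar i)"
    by (intro sum.cong refl) (simp add: prod.reindex[OF inj_on_subset[OF inj]])
  also have "\<dots> = (\<Sum>S\<in>?A. \<Prod>i\<in>S. mvar i)"
  proof (rule sum.reindex_bij_witness[of _ "\<lambda>S. inv_into UNIV \<sigma> ` S" "\<lambda>S. \<sigma> ` S"])
    fix S assume S: "S \<in> ?A"
    show "inv_into UNIV \<sigma> ` \<sigma> ` S = S"
      by (simp add: image_image permutes_inverses[OF assms])
    show "\<sigma> ` inv_into UNIV \<sigma> ` S = S"
      by (simp add: image_image permutes_inverses[OF assms])
    show "\<sigma> ` S \<in> ?A"
      using S permutes_image[OF assms] card_image[OF inj_on_subset[OF inj]] by auto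
    show "inv_into UNIV \<sigma> ` S \<in> ?A"
      using S permutes_image[OF permutes_inv[OF assms]]
        card_image[OF inj_on_subset[OF permutes_inj[OF permutes_inv[OF assms]]]] by auto
  qed auto
  finally show ?thesis by (simp add: esym7_def)
qed

text \<open>The lexicographic order is not well-founded in infinitely many variables. Below
  monomials in \<open>X_0, ..., X_6\<close> it is contained in a lexicographic product of seven
  measures, which is well-founded and drives the reduction.\<close>

lemma less_imp_measures:
  assumes "m < n" "Poly_Mapping.keys n \<subseteq> {0..<7::nat}"
  shows "(m, n :: nat \<Rightarrow>\<^sub>0 nat) \<in> measures (map (\<lambda>i m. Poly_Mapping.lookup m i) [0..<7])"
proof -
  obtain k where k: "Poly_Mapping.lookup m k < Poly_Mapping.lookup n k"
    "\<forall>k'<k. Poly_Mapping.lookup m k' = Poly_Mapping.lookup n k'"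
    using assms(1) unfolding poly_mapping_less_iff by blast
  then have "k \<in> Poly_Mapping.keys n" by (simp add: in_keys_iff)
  with assms(2) have "k < 7" by auto
  \<comment> \<open>From the deciding index \<open>k\<close> the list of measures is extended
    downwards; every prepended measure takes equal values on \<open>m\<close> and
    \<open>n\<close>.\<close>
  have "(m, n) \<in> measures (map (\<lambda>i m. Poly_Mapping.lookup m i) [j..<7])" if "j \<le> k" for j
    using that
  proof (induction rule: inc_induct)
    case base
    then show ?case using k \<open>k < 7\<close> by (simp add: upt_conv_Cons)
  next
    case (step j)
    then show ?case using k(2) \<open>k < 7\<close> by (simp add: upt_conv_Cons)
  qed
  then show ?thesis by blast
qed

text \<open>If the exponent of \<open>X_(i+1)\<close> exceeded that of \<open>X_i\<close>, swapping
  the two variables would give a monomial of \<open>P\<close> lexicographically larger than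
  \<open>m\<close>.\<close>

lemma symmetric_lead_decreasing:
  fixes P :: "'a::comm_ring_1 mpoly"
  assumes sym: "\<And>\<sigma>. \<sigma> permutes {0..<7} \<Longrightarrow> mperm \<sigma> P = P"
    and m: "m \<in> Poly_Mapping.keys P" "\<And>n. n \<in> Poly_Mapping.keys P \<Longrightarrow> n \<le> m"
    and i: "Suc i < 7"
  shows "Poly_Mapping.lookup m (Suc i) \<le> Poly_Mapping.lookup m i"
proof (rule ccontr)
  assume less: "\<not> ?thesis"
  let ?\<tau> = "transpose i (Suc i)"
  have inj: "inj ?\<tau>" by simp
  let ?n = "Poly_Mapping.map_key ?\<tau> m"
  have "mperm ?\<tau> P = P"
    using i by (intro sym permutes_swap_id) auto
  then have "Poly_Mapping.lookup P ?n = Poly_Mapping.lookup P m"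
    using lookup_mperm_involution[of ?\<tau> P m] by simp
  then have "?n \<le> m"
    using m by (auto simp: in_keys_iff)
  moreover have "m < ?n"
    unfolding poly_mapping_less_iff map_key.rep_eq[OF inj]
    using less by (intro exI[of _ i]) auto
  ultimately show False by simp
qed

text \<open>With \<open>a_k = m_(k-1) - m_k\<close> the tail sums telescope to \<open>m_i\<close>.
  The decreasing exponents make the truncated subtraction exact, and \<open>m_7 = 0\<close> ends the
  telescope.\<close>

lemma lead_exp_surj:
  assumes "Poly_Mapping.keys m \<subseteq> {0..<7}"
    and "\<And>i. Suc i < 7 \<Longrightarrow> Poly_Mapping.lookup m (Suc i) \<le> Poly_Mapping.lookup m i"
  obtains a where "Poly_Mapping.keys a \<subseteq> {1..7}" "lead_exp a = m"
proof
  let ?d = "\<lambda>k. Poly_Mapping.lookup m (k - 1) - Poly_Mapping.lookup m k"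
  define a where "a = (\<Sum>k\<in>{1..7}. Poly_Mapping.single k (?d k))"
  have la: "Poly_Mapping.lookup a k = (if k \<in> {1..7} then ?d k else 0)" for k
    unfolding a_def by (simp add: lookup_sum lookup_single when_def)
  show ka: "Poly_Mapping.keys a \<subseteq> {1..7}"
    by (auto simp: in_keys_iff la split: if_splits)
  have m7: "Poly_Mapping.lookup m i = 0" if "7 \<le> i" for i
    using assms(1) that by (force simp: in_keys_iff)
  have dec: "Poly_Mapping.lookup m (Suc i) \<le> Poly_Mapping.lookup m i" for i
    using assms(2)[of i] m7[of "Suc i"] by (cases "Suc i < 7") auto
  have "(\<Sum>k\<in>{Suc i..7}. ?d k) = Poly_Mapping.lookup m i" if "i \<le> 7" for i
    using that
  proof (induction rule: inc_induct)
    case base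
    then show ?case by (simp add: m7)
  next
    case (step n)
    then show ?case using dec[of n] by (simp add: sum.atLeast_Suc_atMost[of "Suc n"])
  qed
  moreover have "Poly_Mapping.lookup (lead_exp a) i = (\<Sum>k\<in>{Suc i..7}. ?d k)" for i
    unfolding lookup_lead_exp[OF ka] by (intro sum.cong) (auto simp: la)
  ultimately have "Poly_Mapping.lookup (lead_exp a) i = Poly_Mapping.lookup m i" for i
    by (cases "i \<le> 7") (simp_all add: m7)
  then show "lead_exp a = m"
    by (rule poly_mapping_eqI)
qed

text \<open>Subtracting the multiple of a product of elementary symmetric polynomials with the same
  leading term leaves a symmetric remainder, which is zero or has a smaller leading monomial.
  \<open>P\<close> is kept nonzero because the induction runs over \<open>Max\<close> of its
  monomials.\<close>

lemma symmetric_reduction_nonzero: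
  fixes P :: "int mpoly"
  assumes "mvars7 P" "\<And>\<sigma>. \<sigma> permutes {0..<7} \<Longrightarrow> mperm \<sigma> P = P"
    "P \<noteq> 0" "Max (Poly_Mapping.keys P) = m"
  shows "\<exists>t. (\<forall>n\<in>Poly_Mapping.keys t. Poly_Mapping.keys n \<subseteq> {1..7}) \<and> minsert of_int esym7 t = P"
  using assms
proof (induction m arbitrary: P rule: wf_induct_rule[OF wf_measures[of "map (\<lambda>i m. Poly_Mapping.lookup m i) [0..<7]"]])
  case (1 m)
  interpret I: unital_hom "of_int :: int \<Rightarrow> int mpoly" by (rule unital_hom_of_int)
  interpret E: unital_hom "minsert of_int esym7 :: int mpoly \<Rightarrow> int mpoly" by (rule unital_hom_minsert_of_int)
  have ne: "Poly_Mapping.keys P \<noteq> {}" using 1 by simp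
  have m: "m \<in> Poly_Mapping.keys P" "\<And>n. n \<in> Poly_Mapping.keys P \<Longrightarrow> n \<le> m"
    using Max_in[OF _ ne] 1(5) by auto
  have km: "Poly_Mapping.keys m \<subseteq> {0..<7}" using 1(2) m(1) by (auto simp: mvars7_def)
  obtain a where a: "Poly_Mapping.keys a \<subseteq> {1..7}" "lead_exp a = m"
    using lead_exp_surj[OF km] symmetric_lead_decreasing[OF 1(3) m] by metis
  let ?c = "Poly_Mapping.lookup P m"
  let ?Q = "of_int ?c * mmonom esym7 a :: int mpoly"
  have L: "monic_lead (mmonom esym7 a :: int mpoly) m"
    using monic_lead_mmonom_esym7[OF a(1)] a(2) by simp
  have tQ: "minsert of_int esym7 (Poly_Mapping.single a ?c) = ?Q" by simp
  have less: "n < m" if "n \<in> Poly_Mapping.keys (P - ?Q)" for n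
  proof -
    have nz: "Poly_Mapping.lookup P n - ?c * Poly_Mapping.lookup (mmonom esym7 a :: int mpoly) n \<noteq> 0"
      using that by (simp add: in_keys_iff lookup_minus lookup_of_int_mult)
    then have "n \<noteq> m" using lookup_monic_lead(1)[OF L] by auto
    moreover have "n \<le> m"
      using nz m(2)[of n] lookup_monic_lead(2)[OF L, of n] unfolding in_keys_iff
      by (cases "Poly_Mapping.lookup P n = 0") auto
    ultimately show ?thesis by simp
  qed
  have ka: "\<forall>n\<in>Poly_Mapping.keys (Poly_Mapping.single a ?c). Poly_Mapping.keys n \<subseteq> {1..7}"
    using a(1) by simp
  show ?case
  proof (cases "P - ?Q = 0")
    case True
    then show ?thesis using tQ ka by (metis right_minus_eq)
  next
    case False
    have symQ: "mperm \<sigma> ?Q = ?Q" if "\<sigma> permutes {0..<7}" for \<sigma>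
    proof -
      interpret S: unital_hom "mperm \<sigma> :: int mpoly \<Rightarrow> int mpoly" by (rule unital_hom_mperm)
      show ?thesis by (simp add: S.hom_of_int S.hom_mmonom mperm_esym7[OF that])
    qed
    have "Poly_Mapping.keys (P - ?Q) \<noteq> {}" using False by simp
    then have "Max (Poly_Mapping.keys (P - ?Q)) < m"
      using less by simp
    then have "(Max (Poly_Mapping.keys (P - ?Q)), m) \<in> measures (map (\<lambda>i m. Poly_Mapping.lookup m i) [0..<7])"
      using km by (rule less_imp_measures)
    moreover have "mvars7 (P - ?Q)"
      using 1(2) by (intro mvars7_diff mvars7_mult mvars7_of_int mvars7_mmonom_esym7)
    moreover have "mperm \<sigma> (P - ?Q) = P - ?Q" if "\<sigma> permutes {0..<7}" for \<sigma>
      using symQ[OF that] 1(3)[OF that] unital_hom.hom_diff[OF unital_hom_mperm] by metis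
    ultimately obtain t where t: "\<forall>n\<in>Poly_Mapping.keys t. Poly_Mapping.keys n \<subseteq> {1..7}"
      "minsert of_int esym7 t = P - ?Q"
      using 1(1) False by blast
    have "minsert of_int esym7 (t + Poly_Mapping.single a ?c) = P"
      using t(2) tQ by simp
    moreover have "\<forall>n\<in>Poly_Mapping.keys (t + Poly_Mapping.single a ?c). Poly_Mapping.keys n \<subseteq> {1..7}"
    proof
      fix n assume "n \<in> Poly_Mapping.keys (t + Poly_Mapping.single a ?c)"
      from subsetD[OF Poly_Mapping.keys_add this] show "Poly_Mapping.keys n \<subseteq> {1..7}"
        by (rule UnE) (fact bspec[OF t(1)] bspec[OF ka])+
    qed
    ultimately show ?thesis by blast
  qed
qed

lemma symmetric_reduction:
  fixes P :: "int mpoly"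
  assumes "mvars7 P" "\<And>\<sigma>. \<sigma> permutes {0..<7} \<Longrightarrow> mperm \<sigma> P = P"
  shows "\<exists>t. (\<forall>n\<in>Poly_Mapping.keys t. Poly_Mapping.keys n \<subseteq> {1..7}) \<and> minsert of_int esym7 t = P"
proof (cases "P = 0")
  case True
  then show ?thesis
    by (intro exI[of _ 0]) (simp add: minsert_mmonom)
next
  case False
  then show ?thesis using symmetric_reduction_nonzero assms by blast
qed

section \<open>An integral formula for the cyclotomic norm form\<close>

text \<open>Expanding \<open>\<Prod>\<^sub>i \<Sum>\<^sub>j \<epsilon>\<^sup>i\<^sup>j x\<^sub>j\<close> and collecting powers of \<open>\<epsilon>\<close> modulo \<open>7\<close> gives the coefficients
  \<open>residue_sum x c\<close>. Those with \<open>c \<noteq> 0\<close> agree because multiplication by a unit permutes the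
  factors, so \<open>\<Sum>\<^sub>k \<epsilon>\<^sup>k = 0\<close> leaves only \<open>psi7\<close>.\<close>

definition residue_sum :: "(nat \<Rightarrow> 'a::comm_ring_1) \<Rightarrow> nat \<Rightarrow> 'a" where
  "residue_sum x c = (\<Sum>f | f \<in> {1..6} \<rightarrow>\<^sub>E {..<7} \<and> (\<Sum>i\<in>{1..6}. i * f i) mod 7 = c. \<Prod>i\<in>{1..6::nat}. x (f i))"

definition psi7 :: "(nat \<Rightarrow> 'a::comm_ring_1) \<Rightarrow> 'a" where
  "psi7 x = residue_sum x 0 - residue_sum x 1"

lemma bij_betw_mult_mod7:
  assumes "u * v mod 7 = (1::nat)"
  shows "bij_betw (\<lambda>i. u * i mod 7) {1..6} {1..6}"
proof (rule bij_betw_byWitness[of _ "\<lambda>i. v * i mod 7"])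
  have inv: "a * (b * i mod 7) mod 7 = i" if "i \<in> {1..6}" "a * b mod 7 = 1" for a b i :: nat
  proof -
    have "a * (b * i mod 7) mod 7 = (a * b mod 7) * i mod 7"
      by (simp add: mod_simps mult_ac)
    then show ?thesis using that by simp
  qed
  have range: "a * i mod 7 \<in> {1..6}" if "i \<in> {1..6}" "b * a mod 7 = 1" for a b i :: nat
  proof -
    have "a * i mod 7 \<noteq> 0"
      using inv[OF that] that(1) by (intro notI) simp
    then show ?thesis by (simp add: Suc_le_eq less_Suc_eq_le[symmetric])
  qed
  show "\<forall>i\<in>{1..6}. v * (u * i mod 7) mod 7 = i"
    using inv[of _ v u] assms by (simp add: mult.commute)
  show "\<forall>i\<in>{1..6}. u * (v * i mod 7) mod 7 = i"
    using inv[of _ u v] assms by simp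
  show "(\<lambda>i. u * i mod 7) ` {1..6} \<subseteq> {1..6}"
    using range[of _ v u] assms by (auto simp: mult.commute)
  show "(\<lambda>i. v * i mod 7) ` {1..6} \<subseteq> {1..6}"
    using range[of _ u v] assms by auto
qed

text \<open>Precomposing \<open>f\<close> with multiplication by \<open>u\<close> only reorders the
  product of the \<open>x (f i)\<close>, while reindexing by \<open>j = u * i\<close> multiplies the
  residue of the sum of the \<open>i * f i\<close> by \<open>v\<close>. \<open>restrict\<close>
  keeps the new function in the extensional function space.\<close>

lemma residue_sum_mult:
  assumes uv: "u * v mod 7 = (1::nat)" and c: "c < 7"
  shows "residue_sum x c = residue_sum x (v * c mod 7)"
proof -
  let ?S = "\<lambda>c. {f. f \<in> {1..6} \<rightarrow>\<^sub>E {..<7} \<and> (\<Sum>i\<in>{1..6}. i * f i) mod 7 = (c::nat)}"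
  let ?F = "\<lambda>u f. restrict (\<lambda>i. f (u * i mod 7)) {1..6}"
  have vu: "v * u mod 7 = 1" using uv by (simp add: mult.commute)
  have inv: "a * (b * i mod 7) mod 7 = i" if "i < 7" "a * b mod 7 = 1" for a b i :: nat
  proof -
    have "a * (b * i mod 7) mod 7 = (a * b mod 7) * i mod 7"
      by (simp add: mod_simps mult_ac)
    then show ?thesis using that by simp
  qed
  have mem: "?F u f \<in> ?S (v * c mod 7)"
    if f: "f \<in> ?S c" and uv: "u * v mod 7 = 1" for f u v c
  proof -
    have bu: "bij_betw (\<lambda>i. u * i mod 7) {1..6} {1..6}"
      by (rule bij_betw_mult_mod7[OF uv])
    have vu: "v * u mod 7 = 1" using uv by (simp add: mult.commute)
    have "(\<Sum>i\<in>{1..6}. i * ?F u f i) = (\<Sum>i\<in>{1..6}. (v * (u * i mod 7) mod 7) * f (u * i mod 7))"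
      using inv[OF _ vu] by (intro sum.cong) auto
    also have "\<dots> = (\<Sum>j\<in>{1..6}. (v * j mod 7) * f j)"
      by (rule sum.reindex_bij_betw[OF bu, of "\<lambda>j. (v * j mod 7) * f j"])
    finally have "(\<Sum>i\<in>{1..6}. i * ?F u f i) mod 7 = (\<Sum>j\<in>{1..6}. ((v * j mod 7) * f j) mod 7) mod 7"
      by (simp add: mod_sum_eq)
    also have "\<dots> = (\<Sum>j\<in>{1..6}. (v * (j * f j)) mod 7) mod 7"
      by (simp add: mod_simps mult_ac)
    also have "\<dots> = v * ((\<Sum>j\<in>{1..6}. j * f j) mod 7) mod 7"
      by (simp add: mod_sum_eq mod_mult_right_eq sum_distrib_left)
    finally have "(\<Sum>i\<in>{1..6}. i * ?F u f i) mod 7 = v * c mod 7"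
      using f by simp
    moreover have "?F u f \<in> {1..6} \<rightarrow>\<^sub>E {..<7}"
      using f bij_betwE[OF bu] by (auto simp: PiE_iff)
    ultimately show ?thesis by simp
  qed
  have FF: "?F a (?F b f) = f" if "f \<in> ?S c" "a * b mod 7 = 1" for a b f c
  proof (rule ext)
    fix i
    have "a * i mod 7 \<in> {1..6}" if "i \<in> {1..6}"
      using bij_betwE[OF bij_betw_mult_mod7[OF \<open>a * b mod 7 = 1\<close>]] that by blast
    then show "?F a (?F b f) i = f i"
      using that inv[of i b a] by (auto simp: PiE_iff extensional_def mult.commute)
  qed
  show ?thesis
    unfolding residue_sum_def
  proof (rule sum.reindex_bij_witness[of _ "?F v" "?F u"])
    fix f assume f: "f \<in> ?S c"
    show "?F v (?F u f) = f" using FF[OF f vu] .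
    show "?F u f \<in> ?S (v * c mod 7)" using mem[OF f uv] .
    show "(\<Prod>i\<in>{1..6}. x (?F u f i)) = (\<Prod>i\<in>{1..6}. x (f i))"
      using prod.reindex_bij_betw[OF bij_betw_mult_mod7[OF uv], of "\<lambda>i. x (f i)"] by simp
  next
    fix f assume f: "f \<in> ?S (v * c mod 7)"
    show "?F u (?F v f) = f" using FF[OF f uv] .
    show "?F v f \<in> ?S c" using mem[OF f vu] inv[OF c uv] by simp
  qed
qed

text \<open>Fermat's little theorem for 7, checked on the six nonzero residues and split so that
  \<open>m ^ 5\<close> is an explicit inverse of \<open>m\<close>.\<close>

lemma power_six_mod7:
  fixes m :: nat
  assumes "m mod 7 \<noteq> 0"
  shows "m ^ 5 * m mod 7 = 1"
proof -
  define c where "c = m mod 7"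
  have "c < 7" "c \<noteq> 0" using assms by (simp_all add: c_def)
  then have "c = 1 \<or> c = 2 \<or> c = 3 \<or> c = 4 \<or> c = 5 \<or> c = 6" by linarith
  then have "c ^ 5 * c mod 7 = 1"
    by (elim disjE) simp_all
  moreover have "m ^ 5 * m mod 7 = c ^ 5 * c mod 7"
    unfolding c_def by (intro mod_mult_cong) (simp_all add: power_mod)
  ultimately show ?thesis
    by (simp only:)
qed

lemma residue_sum_unit:
  assumes "c \<in> {1..6}"
  shows "residue_sum x c = residue_sum x 1"
proof -
  have "c ^ 5 * c mod 7 = 1"
    using assms by (intro power_six_mod7) simp
  then have "residue_sum x 1 = residue_sum x (c * 1 mod 7)"
    by (rule residue_sum_mult) simp
  moreover have "c * 1 mod 7 = c"
    using assms by simp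
  ultimately show ?thesis
    by (simp only:)
qed

text \<open>The condition on \<open>\<epsilon>\<close> is the vanishing of the seventh cyclotomic
  polynomial, so the formula serves both for constants in C[X] and in characteristic
  \<open>p\<close>.\<close>

lemma prod_linear_forms_eq_psi7:
  fixes \<epsilon> :: "'a::comm_ring_1"
  assumes \<epsilon>: "(\<Sum>k<7. \<epsilon> ^ k) = 0"
  shows "(\<Prod>i\<in>{1..6}. \<Sum>j<7. \<epsilon> ^ (i * j) * x j) = psi7 x"
proof -
  let ?P = "{1..6::nat} \<rightarrow>\<^sub>E {..<7::nat}"
  let ?w = "\<lambda>f. \<Sum>i\<in>{1..6}. i * f i :: nat"
  have fin: "finite ?P" by (intro finite_PiE) auto
  have "\<epsilon> ^ 7 - 1 = (\<epsilon> - 1) * (\<Sum>k<7. \<epsilon> ^ k)"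
    by (rule power_diff_1_eq)
  then have e7: "\<epsilon> ^ 7 = 1" using \<epsilon> by simp
  have emod: "\<epsilon> ^ n = \<epsilon> ^ (n mod 7)" for n
  proof -
    have "\<epsilon> ^ n = \<epsilon> ^ (7 * (n div 7) + n mod 7)" by simp
    then show ?thesis by (simp only: power_add power_mult e7 power_one mult_1)
  qed
  have "(\<Prod>i\<in>{1..6}. \<Sum>j<7. \<epsilon> ^ (i * j) * x j) = (\<Sum>f\<in>?P. \<Prod>i\<in>{1..6}. \<epsilon> ^ (i * f i) * x (f i))"
    by (rule prod_sum_PiE) auto
  also have "\<dots> = (\<Sum>f\<in>?P. \<epsilon> ^ (?w f mod 7) * (\<Prod>i\<in>{1..6}. x (f i)))"
    by (simp only: prod.distrib power_sum[symmetric] emod[symmetric])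
  also have "\<dots> = (\<Sum>c<7. \<Sum>f | f \<in> ?P \<and> ?w f mod 7 = c. \<epsilon> ^ (?w f mod 7) * (\<Prod>i\<in>{1..6}. x (f i)))"
    by (rule sum.group[symmetric]) (use fin in auto)
  also have "\<dots> = (\<Sum>c<7. \<epsilon> ^ c * residue_sum x c)"
    unfolding residue_sum_def sum_distrib_left by (intro sum.cong refl) auto
  also have "\<dots> = residue_sum x 0 + (\<Sum>c\<in>{1..6}. \<epsilon> ^ c * residue_sum x 1)"
  proof -
    have "(\<Sum>c\<in>{1..6}. \<epsilon> ^ c * residue_sum x c) = (\<Sum>c\<in>{1..6}. \<epsilon> ^ c * residue_sum x 1)"
      by (intro sum.cong refl) (simp only: residue_sum_unit)
    moreover have "{..<7::nat} = insert 0 {1..6}" by auto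
    ultimately show ?thesis by simp
  qed
  also have "\<dots> = residue_sum x 0 + (\<Sum>c\<in>{1..6}. \<epsilon> ^ c) * residue_sum x 1"
    by (simp only: sum_distrib_right)
  also have "(\<Sum>c\<in>{1..6}. \<epsilon> ^ c) = - 1"
  proof -
    have "{..<7::nat} = insert 0 {1..6}" by auto
    then have "1 + (\<Sum>c\<in>{1..6}. \<epsilon> ^ c) = 0" using \<epsilon> by simp
    then show ?thesis by (simp only: add_eq_0_iff minus_minus) 
  qed
  finally show ?thesis by (simp add: psi7_def)
qed

lemma (in unital_hom) hom_psi7: "\<phi> (psi7 x) = psi7 (\<lambda>i. \<phi> (x i))"
  by (simp add: psi7_def residue_sum_def hom_sum hom_prod)

lemma sum_eps7_powers: "(\<Sum>k<7. eps7 ^ k) = 0"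
proof -
  have "Im eps7 > 0"
    unfolding eps7_def by (simp add: sin_gt_zero)
  then have "eps7 \<noteq> 1" by auto
  moreover have "eps7 ^ 7 = 1"
    by (simp add: eps7_def DeMoivre)
  ultimately show ?thesis by (simp add: geometric_sum)
qed

lemma Psi7_eq_mcomplex: "Psi7 = mcomplex (psi7 mvar)"
proof -
  interpret K: unital_hom "mconst :: complex \<Rightarrow> complex mpoly" by (rule unital_hom_mconst)
  have "Psi7 = (\<Prod>i\<in>{1..6}. \<Sum>j<7. mconst eps7 ^ (i * j) * mvar j)"
    by (simp add: Psi7_def K.hom_power)
  also have "\<dots> = psi7 mvar"
  proof (rule prod_linear_forms_eq_psi7)
    show "(\<Sum>k<7. mconst eps7 ^ k) = 0"
      using sum_eps7_powers K.hom_sum[of "\<lambda>k. eps7 ^ k" "{..<7}"] by (simp add: K.hom_power)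
  qed
  finally show ?thesis
    by (simp add: unital_hom.hom_psi7[OF unital_hom_mcomplex])
qed

section \<open>The reduction of the orbit product\<close>

definition Theta_int :: "int mpoly" where
  "Theta_int = \<Prod> {mperm \<sigma> (psi7 mvar) | \<sigma>. \<sigma> permutes {0..<7}}"

text \<open>\<open>mcomplex\<close> commutes with \<open>mperm\<close> and is injective, so distinct
  orbit elements stay distinct and the two orbit products have matching factors.\<close>

lemma Theta77_eq_mcomplex: "Theta77 = mcomplex Theta_int"
proof -
  interpret unital_hom mcomplex by (rule unital_hom_mcomplex)
  let ?O = "{mperm \<sigma> (psi7 mvar) :: int mpoly | \<sigma>. \<sigma> permutes {0..<7}}"
  have "{mperm \<sigma> Psi7 | \<sigma>. \<sigma> permutes {0..<7}} = mcomplex ` ?O"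
    by (auto simp: Psi7_eq_mcomplex mperm_mcomplex)
  then have "Theta77 = prod id (mcomplex ` ?O)"
    by (simp add: Theta77_def)
  also have "\<dots> = (\<Prod>P\<in>?O. mcomplex P)"
    by (subst prod.reindex) (auto intro: inj_on_subset[OF inj_mcomplex])
  finally show ?thesis
    by (simp add: Theta_int_def hom_prod)
qed

lemma mvars7_Theta_int: "mvars7 Theta_int"
proof -
  have "mvars7 (residue_sum mvar c :: int mpoly)" for c
    unfolding residue_sum_def by (intro mvars7_sum mvars7_prod mvars7_mvar) (auto simp: PiE_iff)
  then have "mvars7 (psi7 mvar :: int mpoly)"
    unfolding psi7_def by (intro mvars7_diff)
  then show ?thesis
    unfolding Theta_int_def using permutes_in_image
    by (intro mvars7_prod) (force intro!: mvars7_mperm)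
qed

lemma mperm_Theta_int:
  assumes \<tau>: "\<tau> permutes {0..<7}"
  shows "mperm \<tau> Theta_int = Theta_int"
proof -
  interpret unital_hom "mperm \<tau> :: int mpoly \<Rightarrow> int mpoly" by (rule unital_hom_mperm)
  let ?O = "{mperm \<sigma> (psi7 mvar) :: int mpoly | \<sigma>. \<sigma> permutes {0..<7}}"
  have inv: "mperm \<tau> (mperm (inv_into UNIV \<tau>) P) = P" "mperm (inv_into UNIV \<tau>) (mperm \<tau> P) = P" for P :: "int mpoly"
    using permutes_inv_o[OF \<tau>] by (simp_all add: mperm_mperm mperm_id)
  have sub: "mperm \<rho> ` ?O \<subseteq> ?O" if "\<rho> permutes {0..<7}" for \<rho>
    using permutes_compose[OF _ that] by (auto simp: mperm_mperm)
  have "mperm \<tau> ` ?O = ?O"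
  proof
    show "?O \<subseteq> mperm \<tau> ` ?O"
    proof
      fix P assume "P \<in> ?O"
      then have "mperm (inv_into UNIV \<tau>) P \<in> ?O" using sub[OF permutes_inv[OF \<tau>]] by blast
      then show "P \<in> mperm \<tau> ` ?O" by (rule rev_image_eqI) (simp add: inv)
    qed
  qed (rule sub[OF \<tau>])
  moreover have "inj_on (mperm \<tau>) ?O"
    by (rule inj_on_inverseI[of _ "mperm (inv_into UNIV \<tau>)"]) (rule inv)
  ultimately have "(\<Prod>P\<in>?O. mperm \<tau> P) = \<Prod>?O"
    using prod.reindex[of "mperm \<tau>" ?O id] by simp
  then show ?thesis
    by (simp add: Theta_int_def hom_prod)
qed

text \<open>Resolves the definite description. Injectivity of \<open>mcomplex\<close> moves the
  defining equation from C[X] to Z[X]; there existence is \<open>symmetric_reduction\<close> and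
  uniqueness is \<open>esym7_algebraically_independent\<close>.\<close>

lemma theta77_spec:
  "(\<forall>m\<in>Poly_Mapping.keys theta77. Poly_Mapping.keys m \<subseteq> {1..7}) \<and> minsert of_int esym7 theta77 = Theta_int"
proof -
  interpret C: unital_hom mcomplex by (rule unital_hom_mcomplex)
  interpret E: unital_hom "minsert of_int esym7 :: int mpoly \<Rightarrow> int mpoly" by (rule unital_hom_minsert_of_int)
  let ?K = "\<lambda>t :: int mpoly. \<forall>m\<in>Poly_Mapping.keys t. Poly_Mapping.keys m \<subseteq> {1..7}"
  have esym: "mcomplex (esym7 k) = esym7 k" for k
    by (simp add: esym7_def C.hom_sum C.hom_prod)
  have "minsert of_int esym7 t = Theta77 \<longleftrightarrow> minsert of_int esym7 t = Theta_int" for t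
  proof -
    have "minsert of_int esym7 t = mcomplex (minsert of_int esym7 t)"
      by (simp add: C.hom_minsert_of_int esym)
    then show ?thesis
      using inj_mcomplex by (simp add: Theta77_eq_mcomplex inj_eq)
  qed
  then have theta: "theta77 = (THE t. ?K t \<and> minsert of_int esym7 t = Theta_int)"
    by (simp add: theta77_def)
  have "\<exists>!t. ?K t \<and> minsert of_int esym7 t = Theta_int"
  proof (rule ex_ex1I)
    show "\<exists>t. ?K t \<and> minsert of_int esym7 t = Theta_int"
      using symmetric_reduction[OF mvars7_Theta_int mperm_Theta_int] by blast
  next
    fix s t :: "int mpoly"
    assume st: "?K s \<and> minsert of_int esym7 s = Theta_int" "?K t \<and> minsert of_int esym7 t = Theta_int"
    have "?K (s - t)"
    proof
      fix n assume "n \<in> Poly_Mapping.keys (s - t)"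
      then have "n \<in> Poly_Mapping.keys s \<or> n \<in> Poly_Mapping.keys t"
        by (auto simp: in_keys_iff lookup_minus)
      with st show "Poly_Mapping.keys n \<subseteq> {1..7}" by blast
    qed
    moreover have "minsert of_int esym7 (s - t) = (0 :: int mpoly)"
      using st by simp
    ultimately have "s - t = 0" by (rule esym7_algebraically_independent)
    then show "s = t" by simp
  qed
  from theI'[OF this] show ?thesis unfolding theta .
qed

text \<open>Evaluating \<open>Theta_int\<close> at \<open>x\<close> gives
  \<open>eval_theta77 c\<close>, because the elementary symmetric polynomials take the values
  \<open>c k\<close>. The identity permutation contributes the factor \<open>psi7 x\<close>, whose
  vanishing would make the product vanish.\<close>

lemma psi7_nonzero:
  fixes x :: "nat \<Rightarrow> 'a::comm_ring_1"
  assumes "eval_theta77 c \<noteq> (0::'a)"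
    and c: "\<And>k. k \<in> {1..7} \<Longrightarrow> c k = (\<Sum>S | S \<subseteq> {0..<7} \<and> card S = k. \<Prod>i\<in>S. x i)"
  shows "psi7 x \<noteq> 0"
proof
  assume "psi7 x = 0"
  interpret I: unital_hom "of_int :: int \<Rightarrow> 'a" by (rule unital_hom_of_int)
  interpret X: unital_hom "minsert of_int x :: int mpoly \<Rightarrow> 'a" by (rule unital_hom_minsert_of_int)
  let ?O = "{mperm \<sigma> (psi7 mvar) :: int mpoly | \<sigma>. \<sigma> permutes {0..<7}}"
  have esym: "minsert of_int x (esym7 k) = c k" if "k \<in> {1..7}" for k
    using c[OF that] by (simp add: esym7_def X.hom_sum X.hom_prod)
  have mon: "mmonom (\<lambda>k. minsert of_int x (esym7 k)) m = mmonom c m" if "m \<in> Poly_Mapping.keys theta77" for m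
  proof -
    have "Poly_Mapping.keys m \<subseteq> {1..7}" using that theta77_spec by blast
    then show ?thesis
      unfolding mmonom_def by (intro prod.cong refl) (simp only: esym subsetD)
  qed
  have "minsert of_int x Theta_int = minsert of_int (\<lambda>k. minsert of_int x (esym7 k)) theta77"
    using theta77_spec X.hom_minsert_of_int[of esym7 theta77] by simp
  also have "\<dots> = eval_theta77 c"
    unfolding eval_theta77_def minsert_mmonom[of _ _ theta77] by (intro sum.cong refl) (simp add: mon)
  finally have "minsert of_int x Theta_int \<noteq> 0" using assms(1) by simp
  moreover have "minsert of_int x Theta_int = 0"
  proof -
    have "finite ?O" using finite_permutations[of "{0..<7::nat}"] by simp
    moreover have "psi7 mvar \<in> ?O"
      by (intro CollectI exI[of _ id]) (simp add: mperm_id permutes_id)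
    moreover have "minsert of_int x (psi7 mvar) = 0"
      using \<open>psi7 x = 0\<close> by (simp add: X.hom_psi7)
    ultimately have "(\<Prod>P\<in>?O. minsert of_int x P) = 0"
      using prod.remove[of ?O "psi7 mvar" "minsert of_int x"] by simp
    then show ?thesis
      by (simp add: Theta_int_def X.hom_prod)
  qed
  ultimately show False by simp
qed

section \<open>Circulant systems\<close>

context unital_hom
begin

lemma map_poly_hom_mult: "map_poly \<phi> (p * q) = map_poly \<phi> p * map_poly \<phi> q"
  by (intro poly_eqI) (simp add: coeff_map_poly coeff_mult hom_sum)

lemma map_poly_hom_diff: "map_poly \<phi> (p - q) = map_poly \<phi> p - map_poly \<phi> q"
  by (intro poly_eqI) (simp add: coeff_map_poly)

lemma map_poly_hom_prod: "map_poly \<phi> (\<Prod>i\<in>A. f i) = (\<Prod>i\<in>A. map_poly \<phi> (f i))"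
  by (induction A rule: infinite_finite_induct) (auto simp: map_poly_hom_mult)

lemma poly_map_poly_hom: "poly (map_poly \<phi> p) (\<phi> x) = \<phi> (poly p x)"
  by (induction p) (auto simp: map_poly_pCons)

end

text \<open>Vieta: \<open>S\<close> collects the factors that contribute \<open>x i\<close>, the
  others contribute the variable. With factors \<open>X + x i\<close> no signs appear; hence the
  negated roots in the final proof.\<close>

lemma esym_eq_coeff_prod:
  fixes x :: "nat \<Rightarrow> 'a::comm_ring_1"
  assumes "k \<le> n"
  shows "(\<Sum>S | S \<subseteq> {0..<n} \<and> card S = k. \<Prod>i\<in>S. x i) = coeff (\<Prod>i<n. [:x i, 1:]) (n - k)"
proof -
  have "(\<Prod>i<n. [:x i, 1:]) = (\<Prod>i<n. [:x i:] + monom 1 1)"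
    by (simp add: monom_altdef)
  also have "\<dots> = (\<Sum>S\<in>Pow {..<n}. (\<Prod>i\<in>S. [:x i:]) * (\<Prod>i\<in>{..<n} - S. monom 1 1))"
    by (rule prod_add) simp
  also have "\<dots> = (\<Sum>S\<in>Pow {..<n}. monom (\<Prod>i\<in>S. x i) (n - card S))"
  proof (intro sum.cong refl)
    fix S assume "S \<in> Pow {..<n}"
    then have S: "finite S" "S \<subseteq> {..<n}" using finite_subset by auto
    have c: "(\<Prod>i\<in>S. [:x i:]) = [:\<Prod>i\<in>S. x i:]" 
      by (induction S rule: infinite_finite_induct) (auto simp: one_pCons)
    have "card ({..<n} - S) = n - card S"
      using S by (simp add: card_Diff_subset)
    then show "(\<Prod>i\<in>S. [:x i:]) * (\<Prod>i\<in>{..<n} - S. monom 1 1) = monom (\<Prod>i\<in>S. x i) (n - card S)"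
      by (simp add: c monom_power smult_monom)
  qed
  finally have "coeff (\<Prod>i<n. [:x i, 1:]) (n - k)
      = (\<Sum>S\<in>Pow {..<n}. if n - card S = n - k then \<Prod>i\<in>S. x i else 0)"
    by (simp add: coeff_sum)
  also have "\<dots> = (\<Sum>S | S \<subseteq> {0..<n} \<and> card S = k. \<Prod>i\<in>S. x i)"
  proof (rule sum.mono_neutral_cong_right)
    have le: "card S \<le> n" if "S \<subseteq> {..<n}" for S
      using card_mono[OF _ that] by simp
    show "\<forall>S\<in>Pow {..<n} - {S. S \<subseteq> {0..<n} \<and> card S = k}. (if n - card S = n - k then \<Prod>i\<in>S. x i else 0) = 0"
    proof
      fix S assume S: "S \<in> Pow {..<n} - {S. S \<subseteq> {0..<n} \<and> card S = k}"
      then have "card S \<noteq> k" "card S \<le> n" using le[of S] by (auto simp: atLeast0LessThan)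
      then show "(if n - card S = n - k then \<Prod>i\<in>S. x i else 0) = 0" using assms by auto
    qed
  qed (auto simp: atLeast0LessThan)
  finally show ?thesis by simp
qed

text \<open>Summing the relations with weights \<open>\<epsilon> ^ (i * s)\<close> gives an
  eigenvalue of the circulant matrix times a Fourier coefficient of \<open>\<gamma>\<close>. The
  eigenvalues are nonzero, so all Fourier coefficients vanish; inverting the transform divides by
  7.\<close>

lemma circulant_kernel_trivial:
  fixes \<epsilon> :: "'a::field" and x \<gamma> :: "nat \<Rightarrow> 'a"
  assumes \<epsilon>: "(\<Sum>k<7. \<epsilon> ^ k) = 0" and char: "(7::'a) \<noteq> 0"
    and per: "\<And>j. x (j + 7) = x j"
    and nz: "\<And>i. i < 7 \<Longrightarrow> (\<Sum>j<7. \<epsilon> ^ (i * j) * x j) \<noteq> 0"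
    and rel: "\<And>s. (\<Sum>j<7. \<gamma> j * x (j + s)) = 0"
    and l: "l < 7"
  shows "\<gamma> l = 0"
proof -
  have "\<epsilon> ^ 7 - 1 = (\<epsilon> - 1) * (\<Sum>k<7. \<epsilon> ^ k)"
    by (rule power_diff_1_eq)
  then have e7: "\<epsilon> ^ 7 = 1" using \<epsilon> by simp
  have e7m: "\<epsilon> ^ (7 * n) = 1" for n
    by (simp only: power_mult e7 power_one)
  have emod: "\<epsilon> ^ (n mod 7) = \<epsilon> ^ n" for n
  proof -
    have "\<epsilon> ^ n = \<epsilon> ^ (7 * (n div 7) + n mod 7)" by simp
    then show ?thesis by (simp only: power_add e7m mult_1)
  qed
  \<comment> \<open>For \<open>\<epsilon> = 1\<close> the sum of the seven powers would be
    7.\<close>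
  have e1: "\<epsilon> \<noteq> 1" using \<epsilon> char by auto
  have orth: "(\<Sum>i<7. \<epsilon> ^ (i * m)) = (if m mod 7 = 0 then 7 else 0)" for m
  proof (cases "m mod 7 = 0")
    case True
    then have "\<epsilon> ^ m = 1" using emod[of m] by simp
    then have "\<epsilon> ^ (i * m) = 1" for i by (simp add: mult.commute[of i] power_mult)
    then show ?thesis using True by simp
  next
    case False
    \<comment> \<open>Raising to the power \<open>m ^ 5\<close> would turn the exponent into 1
      modulo 7 and force \<open>\<epsilon> = 1\<close>.\<close>
    have "\<epsilon> ^ m \<noteq> 1"
    proof
      assume "\<epsilon> ^ m = 1"
      then have "\<epsilon> ^ (m ^ 5 * m) = 1" by (simp only: mult.commute[of "m ^ 5"] power_mult power_one)
      then have "\<epsilon> ^ (m ^ 5 * m mod 7) = 1" by (simp only: emod)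
      then show False using e1 power_six_mod7[OF False] by simp
    qed
    moreover have "(\<epsilon> ^ m) ^ 7 - 1 = (\<epsilon> ^ m - 1) * (\<Sum>i<7. (\<epsilon> ^ m) ^ i)"
      by (rule power_diff_1_eq)
    moreover have "(\<epsilon> ^ m) ^ 7 = 1" by (simp only: power_mult[symmetric] mult.commute[of m] e7m)
    ultimately have "(\<Sum>i<7. (\<epsilon> ^ m) ^ i) = 0" by simp
    then show ?thesis using False by (simp add: power_mult mult.commute[of _ m])
  qed
  have shift: "(\<Sum>s<7. G (j + s)) = (\<Sum>s<7. G s)" if "\<And>t. G (t + 7) = G t" for G :: "nat \<Rightarrow> 'a" and j
  proof (induction j)
    case (Suc j)
    have "(\<Sum>s<7. G (Suc j + s)) + G j = (\<Sum>s<Suc 7. G (j + s))"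
      by (subst sum.lessThan_Suc_shift) simp
    also have "\<dots> = (\<Sum>s<7. G (j + s)) + G j" by (simp only: sum.lessThan_Suc that)
    finally show ?case using Suc by simp
  qed simp
  \<comment> \<open>Exponents are natural numbers, so \<open>6 * i * j\<close> stands for
    \<open>- i * j\<close> modulo 7.\<close>
  have dual: "(\<Sum>j<7. \<gamma> j * \<epsilon> ^ (6 * i * j)) = 0" if i: "i < 7" for i
  proof -
    let ?A = "\<Sum>j<7. \<epsilon> ^ (i * j) * x j"
    have tr: "(\<Sum>s<7. \<epsilon> ^ (i * s) * x (j + s)) = \<epsilon> ^ (6 * i * j) * ?A" for j
    proof -
      have G: "\<epsilon> ^ (i * (t + 7)) * x (t + 7) = \<epsilon> ^ (i * t) * x t" for t
        by (simp only: add_mult_distrib2 power_add per mult.commute[of i 7] e7m mult_1_right)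
      have "?A = (\<Sum>s<7. \<epsilon> ^ (i * (j + s)) * x (j + s))"
        using shift[of "\<lambda>t. \<epsilon> ^ (i * t) * x t" j] G by (simp only:)
      then have "\<epsilon> ^ (6 * i * j) * ?A = (\<Sum>s<7. \<epsilon> ^ (6 * i * j + i * (j + s)) * x (j + s))"
        by (simp add: sum_distrib_left power_add mult.assoc)
      also have "\<dots> = (\<Sum>s<7. \<epsilon> ^ (i * s) * x (j + s))"
      proof (intro sum.cong refl)
        fix s
        have "6 * i * j + i * (j + s) = 7 * (i * j) + i * s" by (simp add: algebra_simps)
        then show "\<epsilon> ^ (6 * i * j + i * (j + s)) * x (j + s) = \<epsilon> ^ (i * s) * x (j + s)"
          by (simp only: power_add e7m mult_1)
      qed
      finally show ?thesis ..
    qed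
    have "0 = (\<Sum>s<7. \<epsilon> ^ (i * s) * (\<Sum>j<7. \<gamma> j * x (j + s)))"
      by (simp only: rel mult_zero_right sum.neutral_const)
    also have "\<dots> = (\<Sum>s<7. \<Sum>j<7. \<gamma> j * (\<epsilon> ^ (i * s) * x (j + s)))"
      by (simp only: sum_distrib_left mult.left_commute)
    also have "\<dots> = (\<Sum>j<7. \<Sum>s<7. \<gamma> j * (\<epsilon> ^ (i * s) * x (j + s)))"
      by (rule sum.swap)
    also have "\<dots> = (\<Sum>j<7. \<gamma> j * (\<epsilon> ^ (6 * i * j) * ?A))"
      by (simp only: sum_distrib_left[symmetric] tr)
    also have "\<dots> = (\<Sum>j<7. \<gamma> j * \<epsilon> ^ (6 * i * j)) * ?A"
      by (simp only: sum_distrib_right mult.assoc)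
    finally show ?thesis using nz[OF i] by (metis mult_eq_0_iff)
  qed
  \<comment> \<open>Fourier inversion at \<open>l\<close>: \<open>l + 6 * j\<close> is
    \<open>l - j\<close> modulo 7, so by \<open>orth\<close> the sum over \<open>i\<close> leaves
    only \<open>j = l\<close>.\<close>
  have "0 = (\<Sum>i<7. \<epsilon> ^ (i * l) * (\<Sum>j<7. \<gamma> j * \<epsilon> ^ (6 * i * j)))"
    by (simp add: dual)
  also have "\<dots> = (\<Sum>i<7. \<Sum>j<7. \<gamma> j * \<epsilon> ^ (i * (l + 6 * j)))"
    by (simp add: sum_distrib_left power_add algebra_simps)
  also have "\<dots> = (\<Sum>j<7. \<Sum>i<7. \<gamma> j * \<epsilon> ^ (i * (l + 6 * j)))"
    by (rule sum.swap)
  also have "\<dots> = (\<Sum>j<7. \<gamma> j * (if (l + 6 * j) mod 7 = 0 then 7 else 0))"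
    by (simp only: sum_distrib_left[symmetric] orth)
  also have "\<dots> = (\<Sum>j<7. if j = l then \<gamma> l * 7 else 0)"
  proof (intro sum.cong refl)
    fix j :: nat assume "j \<in> {..<7}"
    then have j: "j < 7" by simp
    have "(l + 6 * j) mod 7 = 0 \<longleftrightarrow> j = l"
    proof
      assume "(l + 6 * j) mod 7 = 0"
      then obtain t where "l + 6 * j = 7 * t" by (auto simp: mod_eq_0_iff_dvd)
      then have "l + 7 * j = j + 7 * t" by simp
      then have "(l + 7 * j) mod 7 = (j + 7 * t) mod 7" by (rule arg_cong)
      then show "j = l" using l j by simp
    qed simp
    then show "\<gamma> j * (if (l + 6 * j) mod 7 = 0 then 7 else 0) = (if j = l then \<gamma> l * 7 else 0)" by simp
  qed
  also have "\<dots> = \<gamma> l * 7" using l by simp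
  finally show ?thesis using char by simp
qed

section \<open>Frobenius orbits\<close>

text \<open>Multiplication by a nonzero \<open>x\<close> permutes the nonzero elements, so their
  product absorbs the factor \<open>x ^ (q - 1)\<close>, where \<open>q\<close> is the size of the
  field.\<close>

lemma finite_field_power_card:
  fixes x :: "'a::{finite,field}"
  shows "x ^ card (UNIV :: 'a set) = x"
proof (cases "x = 0")
  case True
  then show ?thesis using finite_UNIV_card_ge_0[where ?'a = 'a] by simp
next
  case False
  let ?U = "UNIV - {0} :: 'a set"
  have "(\<Prod>y\<in>?U. x * y) = (\<Prod>y\<in>?U. y)"
    by (rule prod.reindex_bij_witness[of _ "\<lambda>y. y / x" "\<lambda>y. x * y"]) (use False in auto)
  then have "x ^ card ?U * (\<Prod>y\<in>?U. y) = 1 * (\<Prod>y\<in>?U. y)"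
    by (simp add: prod.distrib)
  then have "x ^ card ?U = 1"
    by (subst (asm) mult_cancel_right) auto
  moreover have "card (UNIV :: 'a set) = Suc (card ?U)"
    by (rule card.remove) auto
  ultimately show ?thesis by (simp only: power_Suc mult_1_right)
qed

locale finite_field_embedding = unital_hom h
  for h :: "'a::{finite,field} \<Rightarrow> 'b::field" +
  fixes p k :: nat
  assumes prime_p: "prime p" and card_eq: "card (UNIV :: 'a set) = p ^ k"
begin

abbreviation q where "q \<equiv> p ^ k"

definition frob :: "'b \<Rightarrow> 'b" where
  "frob y = y ^ q"

lemma h_nonzero: "c \<noteq> 0 \<Longrightarrow> h c \<noteq> 0"
  by (metis hom_mult hom_one mult_zero_left right_inverse zero_neq_one)

lemma inj_h: "inj h"
proof (rule injI)
  fix x y assume "h x = h y"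
  then have "h (x - y) = 0" by simp
  then show "x = y" using h_nonzero[of "x - y"] by auto
qed

text \<open>The characteristic of \<open>'a\<close> is a prime dividing \<open>p ^ k\<close>, and
  the injective \<open>h\<close> preserves which multiples of 1 vanish.\<close>

lemma CHAR_eq: "CHAR('b) = p"
proof -
  have "CHAR('a) > 0" by (rule finite_imp_CHAR_pos) simp
  then have "prime CHAR('a)" by (rule prime_CHAR_semidom)
  moreover have "CHAR('a) dvd p ^ k"
    using CHAR_dvd_CARD[where ?'a = 'a] by (simp add: card_eq)
  ultimately have "CHAR('a) = p"
    using prime_p by (meson prime_dvd_power primes_dvd_imp_eq)
  moreover have "(of_nat n = (0::'b)) = (of_nat n = (0::'a))" for n
  proof -
    have "h (of_nat n) = of_nat n"
      by (induction n) auto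
    then show ?thesis
      using h_nonzero[of "of_nat n"] hom_zero by metis
  qed
  ultimately have *: "CHAR('b) dvd n \<longleftrightarrow> p dvd n" for n
    by (metis of_nat_eq_0_iff_char_dvd)
  show ?thesis
    using *[of p] *[of "CHAR('b)"] by (simp add: dvd_antisym)
qed

lemma unital_hom_frob: "unital_hom frob"
proof
  show "frob (x + y) = frob x + frob y" for x y
    unfolding frob_def using prime_p by (intro freshmans_dream'[of _ k]) (simp_all add: CHAR_eq)
qed (simp_all add: frob_def power_mult_distrib)

sublocale frob: unital_hom frob
  by (rule unital_hom_frob)

lemma frob_h [simp]: "frob (h c) = h c"
  using finite_field_power_card[of c] by (simp add: frob_def card_eq flip: hom_power)

lemma inj_frob: "inj frob"
proof (rule injI)
  fix x y assume "frob x = frob y"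
  then have "frob (x - y) = 0" by simp
  then show "x = y" by (simp add: frob_def)
qed

text \<open>\<open>X^q - X\<close> has at most \<open>q\<close> roots, and the \<open>q\<close>
  elements of \<open>range h\<close> already are roots.\<close>

lemma frob_fixed: "frob y = y \<Longrightarrow> y \<in> range h"
proof -
  assume y: "frob y = y"
  have "q > 1"
  proof -
    have "card {0, 1 :: 'a} \<le> card (UNIV :: 'a set)" by (rule card_mono) auto
    then show ?thesis by (simp add: card_eq)
  qed
  let ?P = "monom 1 q - monom 1 1 :: 'b poly"
  have "coeff ?P q = 1" using \<open>q > 1\<close> by simp
  then have nz: "?P \<noteq> 0" by (metis coeff_0 zero_neq_one)
  have deg: "degree ?P \<le> q"
    using \<open>q > 1\<close> by (intro degree_diff_le) (auto simp: degree_monom_eq)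
  let ?Z = "{y. poly ?P y = 0}"
  have Z: "x \<in> ?Z \<longleftrightarrow> frob x = x" for x
    by (simp add: poly_monom frob_def)
  have "range h \<subseteq> ?Z"
  proof
    fix z assume "z \<in> range h"
    then show "z \<in> ?Z" unfolding Z by (elim rangeE) (simp only: frob_h)
  qed
  moreover have "card ?Z \<le> card (range h)"
    using card_poly_roots_bound[OF nz] deg card_image[OF inj_h] card_eq by linarith
  ultimately have "range h = ?Z"
    by (intro card_seteq poly_roots_finite[OF nz])
  then show ?thesis using y Z by blast
qed

text \<open>Division with remainder shows that a nonzero polynomial \<open>d\<close> of least degree
  vanishing at \<open>r\<close> divides \<open>f\<close>; as \<open>d\<close> is no unit and
  \<open>f\<close> is irreducible, \<open>d\<close> has the degree of \<open>f\<close>.\<close>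

lemma degree_le_of_root:
  assumes f: "irreducible f" "poly (map_poly h f) r = 0"
    and g: "g \<noteq> 0" "poly (map_poly h g) r = 0"
  shows "degree f \<le> degree g"
proof -
  let ?I = "\<lambda>g. g \<noteq> 0 \<and> poly (map_poly h g) r = 0"
  obtain d where d: "?I d" "\<And>g. ?I g \<Longrightarrow> degree d \<le> degree g"
    using arg_min_natI[of ?I g degree] arg_min_nat_le[of ?I _ degree] g by blast
  have "f mod d = 0"
  proof (rule ccontr)
    assume nz: "f mod d \<noteq> 0"
    have "f mod d = f - d * (f div d)" by (simp add: minus_mult_div_eq_mod)
    then have "poly (map_poly h (f mod d)) r = 0"
      using f d(1) by (simp add: map_poly_hom_diff map_poly_hom_mult)
    then have "degree d \<le> degree (f mod d)" using nz d(2) by blast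
    moreover have "degree (f mod d) < degree d" using degree_mod_less[of d f] d(1) nz by auto
    ultimately show False by simp
  qed
  then obtain e where e: "f = d * e" by (metis dvd_def mod_0_imp_dvd)
  have "\<not> is_unit d"
  proof
    assume "is_unit d"
    then obtain c where "d = [:c:]" "c \<noteq> 0" using d(1) by (metis is_unit_poly_iff pCons_eq_0_iff)
    then show False using d(1) h_nonzero by (simp add: map_poly_pCons)
  qed
  then have "is_unit e" using f(1) e Factorial_Ring.irreducibleD by blast
  moreover from this have "e \<noteq> 0" by auto
  ultimately have "degree f = degree d"
    using e d(1) by (simp add: is_unit_iff_degree degree_mult_eq)
  then show ?thesis using d(2) g by simp
qed

text \<open>The product over the orbit of \<open>r\<close> is fixed by Frobenius, so by
  \<open>frob_fixed\<close> it comes from a polynomial \<open>g\<close> over \<open>'a\<close>.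
  \<open>degree_le_of_root\<close> for \<open>g\<close> and the number of roots of \<open>f\<close>
  give equal degrees; then \<open>f - g\<close> would have smaller degree while vanishing at
  \<open>r\<close>, so it is 0.\<close>

lemma frobenius_orbit:
  assumes f: "irreducible f" "lead_coeff f = 1" and r: "poly (map_poly h f) r = 0"
  shows "map_poly h f = (\<Prod>i<degree f. [:- (frob ^^ i) r, 1:])"
    and "inj_on (\<lambda>i. (frob ^^ i) r) {..<degree f}"
    and "(frob ^^ degree f) r = r"
proof -
  let ?fK = "map_poly h f"
  have nzK: "?fK \<noteq> 0"
    using f(1) h_nonzero by (subst map_poly_eq_0_iff) auto
  have degK: "degree ?fK = degree f" by (rule degree_map_poly[OF h_nonzero])
  have mapK: "map_poly frob ?fK = ?fK"
    by (intro poly_eqI) (simp add: coeff_map_poly)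
  have root: "poly ?fK ((frob ^^ i) r) = 0" for i
  proof (induction i)
    case (Suc i)
    then show ?case using frob.poly_map_poly_hom[of ?fK "(frob ^^ i) r"] by (simp add: mapK)
  qed (use r in simp)
  \<comment> \<open>All iterates are roots of \<open>f\<close>, and a finite orbit of an injective
    map returns to its start.\<close>
  have "finite {y. \<exists>n. y = (frob ^^ n) r}"
    by (rule finite_subset[OF _ poly_roots_finite[OF nzK]]) (auto simp: root)
  then obtain n0 where n0: "n0 > 0" "(frob ^^ n0) r = r"
    using funpow_inj_finite[OF inj_frob] by blast
  define n where "n = (LEAST n. n > 0 \<and> (frob ^^ n) r = r)"
  have n: "n > 0" "(frob ^^ n) r = r"
    using LeastI[of "\<lambda>n. n > 0 \<and> (frob ^^ n) r = r" n0] n0 by (simp_all add: n_def)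
  have least: "\<not> (m > 0 \<and> (frob ^^ m) r = r)" if "m < n" for m
    using not_less_Least that unfolding n_def by blast
  have inj: "inj_on (\<lambda>i. (frob ^^ i) r) {..<n}"
  proof (rule linorder_inj_onI)
    fix i j assume ij: "i < j" "i \<in> {..<n}" "j \<in> {..<n}"
    show "(frob ^^ i) r \<noteq> (frob ^^ j) r"
    proof
      assume "(frob ^^ i) r = (frob ^^ j) r"
      also have "j = i + (j - i)" using ij by simp
      finally have "(frob ^^ i) r = (frob ^^ i) ((frob ^^ (j - i)) r)"
        by (simp only: funpow_add o_apply)
      then have "(frob ^^ (j - i)) r = r"
        using inj_fn[OF inj_frob, of i] by (simp add: inj_eq)
      then show False using least[of "j - i"] ij by (simp add: less_imp_diff_less)
    qed
  qed auto
  let ?g = "\<Prod>i<n. [:- (frob ^^ i) r, 1:]"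
  have "map_poly frob ?g = (\<Prod>i<n. [:- (frob ^^ Suc i) r, 1:])"
    by (simp add: frob.map_poly_hom_prod map_poly_pCons)
  \<comment> \<open>Frobenius shifts the factors by one; since the iterate \<open>n\<close> is
    \<open>r\<close> again, the last factor becomes the first.\<close>
  also have "\<dots> = ?g"
  proof -
    obtain n' where n': "n = Suc n'" using n(1) by (cases n) auto
    have "(\<Prod>i<n. [:- (frob ^^ Suc i) r, 1:]) = (\<Prod>i<n'. [:- (frob ^^ Suc i) r, 1:]) * [:- r, 1:]"
      using n(2) unfolding n' by (simp only: prod.lessThan_Suc)
    also have "\<dots> = ?g"
      unfolding n' by (subst prod.lessThan_Suc_shift) (simp add: mult.commute)
    finally show ?thesis .
  qed
  finally have gfix: "map_poly frob ?g = ?g" .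
  have "coeff ?g i \<in> range h" for i
    using arg_cong[OF gfix, of "\<lambda>p. coeff p i"] by (intro frob_fixed) (simp add: coeff_map_poly)
  define g where "g = map_poly (inv_into UNIV h) ?g"
  have inv0: "inv_into UNIV h 0 = 0"
    by (metis hom_zero inj_h inv_f_f)
  have gK: "map_poly h g = ?g"
    using \<open>\<And>i. coeff ?g i \<in> range h\<close>
    by (intro poly_eqI) (simp add: g_def coeff_map_poly inv0 f_inv_into_f)
  have degg: "degree ?g = n" by (subst degree_prod_sum_eq) auto
  have lcg: "lead_coeff ?g = 1" by (subst lead_coeff_prod) simp
  have dg: "degree g = n" using degree_map_poly[of h g, OF h_nonzero] gK degg by simp
  have gr: "poly (map_poly h g) r = 0"
    unfolding gK poly_prod using n(1) by (intro prod_zero) (auto intro!: bexI[of _ 0])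
  have "g \<noteq> 0" using dg n(1) by auto
  then have "degree f \<le> n" using degree_le_of_root[OF f(1) r _ gr] dg by simp
  moreover have "n \<le> degree f"
  proof -
    have "n = card ((\<lambda>i. (frob ^^ i) r) ` {..<n})" using card_image[OF inj] by simp
    also have "\<dots> \<le> card {y. poly ?fK y = 0}"
      by (rule card_mono[OF poly_roots_finite[OF nzK]]) (auto simp: root)
    also have "\<dots> \<le> degree f" using card_poly_roots_bound[OF nzK] degK by simp
    finally show ?thesis .
  qed
  ultimately have ndeg: "degree f = n" by simp
  have "lead_coeff (map_poly h g) = 1" using gK lcg by simp
  then have "h (coeff g n) = h 1" using degree_map_poly[of h g, OF h_nonzero] dg by (simp add: coeff_map_poly)
  then have lg: "coeff g n = 1" using inj_h by (simp add: inj_eq del: hom_one)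
  have "f - g = 0"
  proof (rule ccontr)
    assume nz: "f - g \<noteq> 0"
    have "poly (map_poly h (f - g)) r = 0"
      using r gr by (simp add: map_poly_hom_diff)
    then have "n \<le> degree (f - g)" using degree_le_of_root[OF f(1) r nz] ndeg by simp
    moreover have "degree (f - g) \<le> n" using ndeg dg by (intro degree_diff_le) auto
    ultimately have "degree (f - g) = n" by simp
    moreover have "coeff (f - g) n = 0" using f(2) lg ndeg by simp
    ultimately show False using nz by (metis leading_coeff_0_iff)
  qed
  then show "?fK = (\<Prod>i<degree f. [:- (frob ^^ i) r, 1:])" using gK ndeg by simp
  show "inj_on (\<lambda>i. (frob ^^ i) r) {..<degree f}" using inj ndeg by simp
  show "(frob ^^ degree f) r = r" using n(2) ndeg by simp
qed

end

section \<open>Normality\<close>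

lemma exists_seventh_root_sum:
  "\<exists>\<epsilon> :: 'a::alg_closed_field. (\<Sum>k<7. \<epsilon> ^ k) = 0"
proof -
  have "degree ([:1, 1, 1, 1, 1, 1, 1:] :: 'a poly) > 0" by simp
  then obtain \<epsilon> :: 'a where "poly [:1, 1, 1, 1, 1, 1, 1:] \<epsilon> = 0"
    using alg_closed_imp_poly_has_root by blast
  then have "(\<Sum>k<7. \<epsilon> ^ k) = 0"
    by (simp add: eval_nat_numeral algebra_simps)
  then show ?thesis ..
qed

lemma unital_hom_to_ac: "unital_hom (to_ac :: 'a::field \<Rightarrow> 'a alg_closure)"
  by unfold_locales auto

theorem theorem4p1:
  fixes a :: "'a::{finite,field}"
    and h :: "'a \<Rightarrow> 'b::field"
    and p k :: nat
  assumes "prime p" and "card (UNIV :: 'a set) = p ^ k" and "p \<noteq> 7"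
    and "irreducible ([:a, 0, 0, 0, 0, 0, 1, 1:] :: 'a poly)"
    and "eval_theta77 (\<lambda>i. if i = 1 then 1 else if i = 7 then a else 0) \<noteq> (0::'a)"
    and "h 1 = 1" and "\<And>x y. h (x + y) = h x + h y" and "\<And>x y. h (x * y) = h x * h y"
    and "size (proots (map_poly h [:a, 0, 0, 0, 0, 0, 1, 1:])) = 7"
  shows "normal_poly_over h [:a, 0, 0, 0, 0, 0, 1, 1:]"
proof -
  interpret finite_field_embedding h p k
    by unfold_locales (use assms in auto)
  interpret T: unital_hom "to_ac :: 'b \<Rightarrow> 'b alg_closure" by (rule unital_hom_to_ac)
  let ?f = "[:a, 0, 0, 0, 0, 0, 1, 1:]"
  let ?c = "\<lambda>i. if i = 1 then 1 else if i = 7 then a else 0"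
  define fK where "fK = map_poly h ?f"
  have fK: "fK = [:h a, 0, 0, 0, 0, 0, 1, 1:]" by (simp add: fK_def map_poly_pCons)
  then have fK0: "fK \<noteq> 0" by simp
  have "proots fK \<noteq> {#}" using assms(9) by (auto simp: fK_def)
  then obtain r where "r \<in># proots fK" by blast
  then have r: "poly fK r = 0" using fK0 by simp
  \<comment> \<open>Negation turns the linear factors into \<open>X + x i\<close>, so the elementary
    symmetric functions of \<open>x\<close> are coefficients of \<open>fK\<close> without
    signs.\<close>
  define x where "x i = - (frob ^^ i) r" for i
  have "lead_coeff ?f = 1" "degree ?f = 7" by simp_all
  note orbit = frobenius_orbit[OF assms(4) this(1) r[unfolded fK_def], unfolded this(2), folded fK_def]
  have frob_x: "x (i + s) = (frob ^^ s) (x i)" for i s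
  proof (induction s)
    case (Suc s)
    have "x (Suc n) = frob (x n)" for n by (simp add: x_def)
    then show ?case using Suc by simp
  qed simp
  have per: "x (j + 7) = x j" for j
    using orbit(3) by (simp only: x_def funpow_add o_apply)
  have prod_x: "fK = (\<Prod>i<7. [:x i, 1:])" using orbit(1) by (simp add: x_def)
  have inj_x: "inj_on (\<lambda>i. - x i) {..<7}" using orbit(2) by (simp add: x_def)
  have esym_x: "(\<Sum>S | S \<subseteq> {0..<7} \<and> card S = m. \<Prod>i\<in>S. x i) = h (?c m)" if "m \<in> {1..7}" for m
  proof -
    have "(\<Sum>S | S \<subseteq> {0..<7} \<and> card S = m. \<Prod>i\<in>S. x i) = coeff fK (7 - m)"
      unfolding prod_x using that by (intro esym_eq_coeff_prod) simp
    moreover have "m = 1 \<or> m = 2 \<or> m = 3 \<or> m = 4 \<or> m = 5 \<or> m = 6 \<or> m = 7"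
      using that unfolding atLeastAtMost_iff by linarith
    ultimately show ?thesis
      by (elim disjE) (simp_all add: fK eval_nat_numeral)
  qed
  \<comment> \<open>The hypothesis lives in \<open>'a\<close>; evaluation commutes with
    \<open>h\<close>, which carries it to the field containing the roots.\<close>
  have "eval_theta77 (\<lambda>i. h (?c i)) = h (eval_theta77 ?c)"
    unfolding eval_theta77_def by (simp only: hom_minsert_of_int)
  then have "eval_theta77 (\<lambda>i. h (?c i)) \<noteq> 0"
    using assms(5) h_nonzero by metis
  then have psi: "psi7 x \<noteq> 0"
    by (rule psi7_nonzero) (simp only: esym_x)
  \<comment> \<open>This is the eigenvalue for \<open>i = 0\<close>, the one that
    \<open>psi7\<close> does not cover; it is the coefficient of \<open>X^6\<close> in
    \<open>f\<close>.\<close>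
  have sum_x: "(\<Sum>i<7. x i) = 1"
  proof -
    have "{S. S \<subseteq> {0..<7} \<and> card S = 1} = (\<lambda>i. {i}) ` {..<7::nat}"
      by (auto simp: card_1_singleton_iff)
    then have "(\<Sum>S | S \<subseteq> {0..<7} \<and> card S = 1. \<Prod>i\<in>S. x i) = (\<Sum>i<7. x i)"
      by (simp add: sum.reindex)
    then show ?thesis using esym_x[of 1] by simp
  qed
  \<comment> \<open>\<open>'b\<close> may lack primitive seventh roots of unity, so the eigenvalues
    are taken in its algebraic closure.\<close>
  obtain \<epsilon> :: "'b alg_closure" where \<epsilon>: "(\<Sum>k<7. \<epsilon> ^ k) = 0"
    using exists_seventh_root_sum by blast
  have ac0: "to_ac y = 0 \<longleftrightarrow> y = 0" for y :: 'b
    by (metis T.hom_mult T.hom_one T.hom_zero mult_zero_left right_inverse zero_neq_one)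
  have nz: "(\<Sum>j<7. \<epsilon> ^ (i * j) * to_ac (x j)) \<noteq> 0" if "i < 7" for i
  proof (cases "i = 0")
    case True
    then show ?thesis using sum_x by (simp flip: T.hom_sum)
  next
    case False
    have "(\<Prod>i\<in>{1..6}. \<Sum>j<7. \<epsilon> ^ (i * j) * to_ac (x j)) = to_ac (psi7 x)"
      by (simp only: prod_linear_forms_eq_psi7[OF \<epsilon>] T.hom_psi7)
    then have "(\<Prod>i\<in>{1..6}. \<Sum>j<7. \<epsilon> ^ (i * j) * to_ac (x j)) \<noteq> 0"
      using psi by (simp only: ac0 not_False_eq_True)
    then show ?thesis using that False by (subst (asm) prod_zero_iff) auto
  qed
  have char: "(7 :: 'b alg_closure) \<noteq> 0"
  proof
    assume "(7 :: 'b alg_closure) = 0"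
    then have "to_ac (of_nat 7 :: 'b) = 0" by simp
    then have "p dvd 7" using CHAR_eq of_nat_eq_0_iff_char_dvd[where ?'a = 'b, of 7] by (simp only: ac0)
    then show False using assms(1,3) primes_dvd_imp_eq[of p 7] by simp
  qed
  have "poly fK z = 0 \<longleftrightarrow> (\<exists>i<7. z = - x i)" for z
    by (auto simp: prod_x poly_prod eq_neg_iff_add_eq_0 add.commute)
  then have roots: "set_mset (proots fK) = (\<lambda>i. - x i) ` {..<7}"
    unfolding set_count_proots[OF fK0] by blast
  have simple: "count (proots fK) y \<le> 1" for y
  proof (rule ccontr)
    assume y: "\<not> count (proots fK) y \<le> 1"
    \<comment> \<open>Each root counts at least once, so a multiple root would make the total exceed
      the number of distinct roots; yet both are 7.\<close>
    have "(\<Sum>z\<in>set_mset (proots fK). 1) < (\<Sum>z\<in>set_mset (proots fK). count (proots fK) z)"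
    proof (rule sum_strict_mono_ex1)
      show "\<forall>z\<in>set_mset (proots fK). 1 \<le> count (proots fK) z"
        by (simp only: count_greater_eq_one_iff Ball_def simp_thms)
      show "\<exists>z\<in>set_mset (proots fK). 1 < count (proots fK) z"
        using y by (intro bexI[of _ y]) (auto intro: count_inI)
    qed simp
    then have "card (set_mset (proots fK)) < size (proots fK)"
      unfolding size_multiset_overloaded_eq by (simp only: card_eq_sum)
    moreover have "card (set_mset (proots fK)) = size (proots fK)"
      unfolding roots card_image[OF inj_x] using assms(9) by (simp add: fK_def)
    ultimately show False by simp
  qed
  have indep: "c y = 0" if rel: "(\<Sum>y\<in>set_mset (proots fK). h (c y) * y) = 0" and y: "y \<in># proots fK" for c y
  proof -
    obtain l where l: "l < 7" "y = - x l" using y roots by auto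
    have "(\<Sum>j<7. h (c (- x j)) * - x j) = 0"
      using rel unfolding roots by (simp add: sum.reindex[OF inj_x])
    then have rel0: "(\<Sum>j<7. h (c (- x j)) * x j) = 0"
      by (simp add: sum_negf)
    \<comment> \<open>Frobenius fixes the coefficients in \<open>range h\<close> and shifts
      \<open>x\<close> by one, so one relation yields all its cyclic shifts.\<close>
    have rels: "(\<Sum>j<7. h (c (- x j)) * x (j + s)) = 0" for s
    proof (induction s)
      case (Suc s)
      have "0 = frob (\<Sum>j<7. h (c (- x j)) * x (j + s))" by (simp add: Suc)
      also have "\<dots> = (\<Sum>j<7. h (c (- x j)) * x (j + Suc s))"
        by (simp add: frob.hom_sum x_def)
      finally show ?case ..
    qed (use rel0 in simp)
    have "to_ac (h (c (- x l))) = 0"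
    proof (rule circulant_kernel_trivial[OF \<epsilon> char, of "\<lambda>j. to_ac (x j)" "\<lambda>j. to_ac (h (c (- x j)))"])
      show "(\<Sum>j<7. to_ac (h (c (- x j))) * to_ac (x (j + s))) = 0" for s
        using arg_cong[OF rels[of s], of to_ac] by (simp add: T.hom_sum)
    qed (use nz per l in auto)
    then show ?thesis using h_nonzero l by (auto simp: ac0)
  qed
  show ?thesis
    unfolding normal_poly_over_def roots_lin_indep_over_def Let_def fK_def[symmetric]
    using assms(4) simple indep by auto
qed

end
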